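(* Let $\gamma>3/4$ and let $v:[0,\infty)\to\mathbb{R}$ be measurable with $|v(t)|\lesssim\langle t\rangle^{-\gamma}$. Let $x(t,k)=(x_n(t,k))_{n\ge0}$, $k\in\mathbb{R}$, be the $\ell^2$-valued solution of $$x_n'=ikn^2x_n+iv(t)(x_{n-1}+x_{n+1})\ (n\ge1),\qquad x_0'=iv(t)x_1,\qquad x_n(0,k)=\delta_{n,0},$$ and let $S_N(T,k)=\sum_{n=N}^\infty|x_n(T,k)|^2$. Then there is an absolute constant $C$ such that for any $2\le p\le\infty$, any integer $N>1$ and any $T>0$, $$\|S_N(T,\cdot)\|_{L^p(\mathbb{R},dk)}\le C\,N^{-2+2p^{-1}}\left(\int_0^T|v(t)|dt\right)^{2-2/p}\left(\int_0^Tv^2(\tau)d\tau\right)^{1/p}.$$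
   Context: $\langle t\rangle=(1+t^2)^{1/2}$. The system is the evolution $x_t=ik\Lambda x+iQ(t)x$, $x(0,k)=\delta_0$ in $\ell^2(\mathbb{Z}_{\ge 0})$, with $\Lambda$ diagonal with eigenvalues $n^2$, $n=0,1,\dots$, and $Q_{mn}(t)=v(t)$ if $|m-n|=1$ and $0$ otherwise; solutions are understood in the weak (Duhamel) sense: $x(t,k)=e^{ikt\Lambda}\delta_0+i\int_0^te^{ik(t-\tau)\Lambda}Q(\tau)x(\tau,k)d\tau$. *)

theory Defs
  imports "HOL-Analysis.Analysis" "HOL-Probability.Essential_Supremum"
begin

definition japanese_bracket :: "real \<Rightarrow> real" where
  "japanese_bracket t = sqrt (1 + t\<^sup>2)"

definition ell2 :: "(nat \<Rightarrow> complex) set" where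
  "ell2 = {y. summable (\<lambda>n. (cmod (y n))\<^sup>2)}"

definition ell2_norm :: "(nat \<Rightarrow> complex) \<Rightarrow> real" where
  "ell2_norm y = sqrt (\<Sum>n. (cmod (y n))\<^sup>2)"

text \<open>
  Bochner integration in the Hilbert space of square-summable sequences. The space is separable,
  so by Pettis' theorem strong measurability amounts to measurability of all coordinates, and the
  coordinate functionals commute with the Bochner integral.
\<close>

definition ell2_integrable :: "real set \<Rightarrow> (real \<Rightarrow> nat \<Rightarrow> complex) \<Rightarrow> bool" where
  "ell2_integrable A F \<longleftrightarrow>
     (\<forall>t\<in>A. F t \<in> ell2) \<and>
     (\<forall>n. set_borel_measurable lebesgue A (\<lambda>t. F t n)) \<and>
     set_integrable lebesgue A (\<lambda>t. ell2_norm (F t))"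

definition ell2_integral :: "real set \<Rightarrow> (real \<Rightarrow> nat \<Rightarrow> complex) \<Rightarrow> nat \<Rightarrow> complex" where
  "ell2_integral A F = (\<lambda>n. set_lebesgue_integral lebesgue A (\<lambda>t. F t n))"

definition delta0 :: "nat \<Rightarrow> complex" where
  "delta0 = (\<lambda>n. if n = 0 then 1 else 0)"

text \<open>The unitary operator \<open>exp (i s \<Lambda>)\<close>, where \<open>\<Lambda>\<close> is diagonal with eigenvalues \<open>n\<^sup>2\<close>.\<close>

definition free_evol :: "real \<Rightarrow> (nat \<Rightarrow> complex) \<Rightarrow> nat \<Rightarrow> complex" where
  "free_evol s y = (\<lambda>n. cis (s * (real n)\<^sup>2) * y n)"

text \<open>
  The tridiagonal matrix with entry \<open>a\<close> where the row and column indices differ by one, and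
  \<open>0\<close> elsewhere.
\<close>

definition Qop :: "real \<Rightarrow> (nat \<Rightarrow> complex) \<Rightarrow> nat \<Rightarrow> complex" where
  "Qop a y = (\<lambda>n. complex_of_real a * ((if n = 0 then 0 else y (n - 1)) + y (n + 1)))"

text \<open>
  The function \<open>y\<close> on the half-line solves \<open>y' = i k \<Lambda> y + i Q(t) y\<close>, \<open>y(0) = delta0\<close>
  in the weak (Duhamel) sense; values of \<open>y\<close> at negative times are irrelevant.
\<close>

definition duhamel_solution :: "(real \<Rightarrow> real) \<Rightarrow> real \<Rightarrow> (real \<Rightarrow> nat \<Rightarrow> complex) \<Rightarrow> bool" where
  "duhamel_solution v k y \<longleftrightarrow>
     (\<forall>t\<ge>0. y t \<in> ell2 \<and>
        ell2_integrable {0..t} (\<lambda>\<tau>. free_evol (k * (t - \<tau>)) (Qop (v \<tau>) (y \<tau>))) \<and>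
        (\<forall>n. y t n = free_evol (k * t) delta0 n
           + \<i> * ell2_integral {0..t} (\<lambda>\<tau>. free_evol (k * (t - \<tau>)) (Qop (v \<tau>) (y \<tau>))) n))"

definition tail_mass :: "nat \<Rightarrow> (nat \<Rightarrow> complex) \<Rightarrow> real" where
  "tail_mass N y = (\<Sum>j. (cmod (y (N + j)))\<^sup>2)"

text \<open>
  The \<open>L\<^sup>p\<close> norm for \<open>1 \<le> p \<le> \<infinity>\<close>, with value \<open>\<infinity>\<close> outside of \<open>L\<^sup>p\<close>. As with
  \<open>esssup\<close>, non-measurable functions get the value \<open>\<infinity>\<close>.
\<close>

definition Lp_norm :: "'a measure \<Rightarrow> ennreal \<Rightarrow> ('a \<Rightarrow> real) \<Rightarrow> ennreal" where
  "Lp_norm M p f =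
     (if f \<notin> borel_measurable M then \<infinity>
      else if p = \<infinity> then esssup M (\<lambda>x. ennreal \<bar>f x\<bar>)
      else (let I = (\<integral>\<^sup>+ x. ennreal (\<bar>f x\<bar> powr enn2real p) \<partial>M) in
            if I = \<infinity> then \<infinity> else ennreal (enn2real I powr (1 / enn2real p))))"

end

theory Submission
  imports Defs "HOL-Probability.Sinc_Integral"
begin

text \<open>
  Everything rests on two estimates for \<open>S\<^sub>N\<close>: one pointwise in the frequency \<open>k\<close>, one integrated over \<open>k\<close>.
  Since \<open>S\<^sub>N \<ge> 0\<close>, the bound \<open>S\<^sub>N \<le> B\<close> together with \<open>\<integral> S\<^sub>N dk \<le> D\<close> gives
  \<open>\<parallel>S\<^sub>N\<parallel>\<^sub>p \<le> B\<^bsup>1-1/p\<^esup> D\<^bsup>1/p\<^esup>\<close> (\<open>Lp_norm_interpolation\<close>), and with \<open>B\<close> a multiple of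
  \<open>N\<^bsup>-2\<^esup> (\<integral>|v|)\<^sup>2\<close> and \<open>D\<close> a multiple of \<open>\<integral>v\<^sup>2\<close> this is the theorem.

  The pointwise bound (\<open>tail_mass_le\<close>). The mass \<open>\<Sum>|x\<^sub>n|\<^sup>2\<close> is conserved and only moves between
  neighbouring sites, at a rate at most \<open>2|v||x\<^sub>n||x\<^sub>n\<^sub>+\<^sub>1|\<close>. A weight growing like \<open>n\<^sup>2\<close>, cut off at \<open>N\<close>, has increments of size
  \<open>n\<close>, so the weighted mass \<open>E\<close> satisfies \<open>E(T) \<le> 4 \<integral>|v| E\<^bsup>1/2\<^esup>\<close> by Cauchy-Schwarz, whence
  \<open>E \<le> 16 (\<integral>|v|)\<^sup>2\<close>, while \<open>N\<^sup>2 S\<^sub>N \<le> E\<close>.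

  The integrated bound (\<open>ground_state_loss_integral_le\<close>). Here \<open>S\<^sub>N \<le> 1 - |x\<^sub>0|\<^sup>2 \<le> 2 Re (1 - x\<^sub>0)\<close>.
  Because \<open>\<Lambda> \<ge> 0\<close>, every \<open>x\<^sub>n(t,\<cdot>)\<close> is a boundary value of a bounded analytic function in the upper
  half-plane of \<open>k\<close>; in other words its Fourier spectrum is one-sided. Two applications of Duhamel's formula give
  \<open>1 - x\<^sub>0(T,k) = \<integral>\<integral> v(s) v(r) e\<^bsup>ik(s-r)\<^esup> (x\<^sub>0 + x\<^sub>2)(r,k) dr ds\<close> over \<open>r < s\<close>. Averaged against a
  Fejer kernel of width \<open>1/\<epsilon>\<close>, whose Fourier transform is supported in \<open>[-\<epsilon>, \<epsilon>]\<close>, all terms with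
  \<open>s - r \<ge> \<epsilon>\<close> vanish, and the remaining ones are bounded by means of \<open>|x\<^sub>0 + x\<^sub>2| \<le> 2\<close>. The result is
  \<open>O(\<integral>v\<^sup>2)\<close> uniformly in \<open>\<epsilon>\<close>, and \<open>\<epsilon> \<rightarrow> 0\<close> by Fatou's lemma. The bound on
  \<open>x\<^sub>0 + x\<^sub>2\<close> comes from conservation of mass and is the same for all \<open>v\<close>, which is why the constant is absolute.

  One-sidedness and measurability in \<open>k\<close> are both obtained by passing to the limit in Picard's iteration, which converges
  to the given solution.
\<close>

section \<open>Integrals over compact intervals\<close>

lemma borel_measurable_cnj [measurable (raw)]:
  "f \<in> borel_measurable M \<Longrightarrow> (\<lambda>x. cnj (f x)) \<in> borel_measurable M"
  by (rule borel_measurable_continuous_on[where f=cnj]) (auto intro: continuous_intros)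

lemma set_integrable_bounded_Icc:
  fixes f :: "real \<Rightarrow> 'a::{banach, second_countable_topology}"
  assumes [measurable]: "f \<in> borel_measurable borel"
    and "\<And>s. s \<in> {a..b} \<Longrightarrow> norm (f s) \<le> B"
  shows "set_integrable lborel {a..b} f"
proof -
  have "set_integrable lborel {a..b} (\<lambda>_. B)"
    unfolding set_integrable_def by (intro integrable_scaleR_left integrable_real_indicator)
      (simp_all add: emeasure_lborel_Icc_eq)
  then show ?thesis
    by (rule set_integrable_bound) (use assms in \<open>auto simp: set_borel_measurable_def\<close>, fastforce)
qed

lemma norm_set_integral_Icc_le:
  fixes f :: "real \<Rightarrow> 'a::{banach, second_countable_topology}"
  assumes "f \<in> borel_measurable borel" "a \<le> b"
    and "\<And>s. s \<in> {a..b} \<Longrightarrow> norm (f s) \<le> B"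
  shows "norm (LINT s:{a..b}|lborel. f s) \<le> B * (b - a)"
proof -
  have "0 \<le> B" using assms(2) assms(3)[of a] by (auto intro: order_trans[OF norm_ge_zero])
  have "norm (LINT s:{a..b}|lborel. f s) \<le> (LINT s:{a..b}|lborel. norm (f s))"
    using set_integrable_bounded_Icc[of f a b B] assms by (intro set_integral_norm_bound) auto
  also have "\<dots> \<le> (LINT s:{a..b}|lborel. B)"
    using assms by (intro set_integral_mono set_integrable_bounded_Icc[where B=B]) (auto simp: \<open>0 \<le> B\<close>)
  also have "\<dots> = B * (b - a)" using assms by (simp add: set_integral_const)
  finally show ?thesis .
qed

lemma set_integral_Icc_split:
  fixes f :: "real \<Rightarrow> 'a::{banach, second_countable_topology}"
  assumes "set_integrable lborel {a..c} f" "a \<le> b" "b \<le> c"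
  shows "(LINT s:{a..c}|lborel. f s) = (LINT s:{a..b}|lborel. f s) + (LINT s:{b..c}|lborel. f s)"
proof -
  have eq: "{a..c} = {a..b} \<union> {b..c}" using assms by auto
  show ?thesis unfolding eq
  proof (rule set_integral_Un_AE)
    show "AE x in lborel. \<not> (x \<in> {a..b} \<and> x \<in> {b..c})"
      using AE_lborel_singleton[of b] by eventually_elim auto
  qed (use assms eq in \<open>auto intro: set_integrable_subset\<close>)
qed

text \<open>
  Increments of second order force the derivative to vanish. This replaces the fundamental theorem of
  calculus for Lipschitz functions, which have a derivative only almost everywhere.
\<close>

lemma constant_if_quadratic_increments:
  fixes h :: "real \<Rightarrow> real"
  assumes "\<And>a b. 0 \<le> a \<Longrightarrow> a \<le> b \<Longrightarrow> b \<le> T \<Longrightarrow> \<bar>h b - h a\<bar> \<le> B * (b - a)\<^sup>2"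
    and "0 \<le> T"
  shows "h T = h 0"
proof -
  have bd: "\<bar>h b - h a\<bar> \<le> B * \<bar>b - a\<bar> * \<bar>b - a\<bar>" if "a \<in> {0..T}" "b \<in> {0..T}" for a b
    using assms(1)[of a b] assms(1)[of b a] that
    by (cases "a \<le> b") (auto simp: power2_eq_square abs_minus_commute mult.assoc)
  have "(h has_real_derivative 0) (at a within {0..T})" if a: "a \<in> {0..T}" for a
  proof -
    have "((\<lambda>b. (h b - h a) / (b - a)) \<longlongrightarrow> 0) (at a within {0..T})"
    proof (rule Lim_null_comparison)
      show "\<forall>\<^sub>F b in at a within {0..T}. norm ((h b - h a) / (b - a)) \<le> B * \<bar>b - a\<bar>"
        unfolding eventually_at_filter
        using bd[OF a] by (auto simp: field_simps intro!: always_eventually)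
      show "((\<lambda>b. B * \<bar>b - a\<bar>) \<longlongrightarrow> 0) (at a within {0..T})"
        by (auto intro!: tendsto_eq_intros)
    qed
    then show ?thesis by (simp add: has_field_derivative_iff)
  qed
  then show ?thesis
    using has_derivative_zero_constant[of "{0..T}" h] assms(2)
      has_field_derivative_zero_constant[of "{0..T}" h]
    by (metis atLeastAtMost_iff convex_real_interval(5) order_refl)
qed

text \<open>
  The product rule for \<open>|F|\<^sup>2\<close> when \<open>F' = f\<close> holds only almost everywhere. Over \<open>[a, b]\<close> the two sides differ by
  \<open>|F b - F a|\<^sup>2\<close> and by the error of replacing \<open>F s\<close> with \<open>F a\<close> under the integral; both are \<open>O((b - a)\<^sup>2)\<close>
  because \<open>F\<close> is Lipschitz.
\<close>

lemma norm_square_indefinite_integral: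
  fixes f :: "real \<Rightarrow> complex"
  assumes [measurable]: "f \<in> borel_measurable borel"
    and B: "\<And>s. s \<in> {0..T} \<Longrightarrow> cmod (f s) \<le> B"
    and F: "\<And>t. t \<in> {0..T} \<Longrightarrow> F t = c + (LINT s:{0..t}|lborel. f s)"
    and [measurable]: "F \<in> borel_measurable borel"
    and T: "0 \<le> T"
  shows "(cmod (F T))\<^sup>2 = (cmod c)\<^sup>2 + (LINT s:{0..T}|lborel. 2 * Re (cnj (F s) * f s))"
proof -
  have B0: "0 \<le> B" using B[of 0] T by (auto intro: order_trans[OF norm_ge_zero])
  have intf: "set_integrable lborel {a..b} f" if "0 \<le> a" "b \<le> T" for a b
    using that B by (intro set_integrable_bounded_Icc[where B=B]) auto
  have inc: "F b - F a = (LINT s:{a..b}|lborel. f s)" if "0 \<le> a" "a \<le> b" "b \<le> T" for a b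
    using that F[of a] F[of b] set_integral_Icc_split[OF intf, of 0 b a] by auto
  have lip: "cmod (F b - F a) \<le> B * (b - a)" if "0 \<le> a" "a \<le> b" "b \<le> T" for a b
    unfolding inc[OF that] using that B by (intro norm_set_integral_Icc_le) auto
  have Fb: "cmod (F s) \<le> cmod (F 0) + B * T" if "s \<in> {0..T}" for s
  proof -
    have "cmod (F s) \<le> cmod (F 0) + cmod (F s - F 0)" by (metis add.commute diff_add_cancel norm_triangle_ineq)
    also have "cmod (F s - F 0) \<le> B * T"
      using lip[of 0 s] that B0 by (auto intro: order_trans mult_left_mono)
    finally show ?thesis by simp
  qed
  define g where "g = (\<lambda>s. 2 * Re (cnj (F s) * f s))"
  have [measurable]: "g \<in> borel_measurable borel" unfolding g_def by measurable
  have gb: "\<bar>g s\<bar> \<le> 2 * ((cmod (F 0) + B * T) * B)" if "s \<in> {0..T}" for s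
  proof -
    have "\<bar>Re (cnj (F s) * f s)\<bar> \<le> cmod (F s) * cmod (f s)"
      by (metis abs_Re_le_cmod complex_mod_cnj norm_mult)
    also have "\<dots> \<le> (cmod (F 0) + B * T) * B"
      using Fb[OF that] B[OF that] B0 T by (intro mult_mono) (auto intro!: add_nonneg_nonneg)
    finally show ?thesis by (simp add: g_def)
  qed
  have intg: "set_integrable lborel {a..b} g" if "0 \<le> a" "b \<le> T" for a b
    using that gb by (intro set_integrable_bounded_Icc[where B="2 * ((cmod (F 0) + B * T) * B)"]) auto
  define h where "h = (\<lambda>t. (cmod (F t))\<^sup>2 - (LINT s:{0..t}|lborel. g s))"
  have "h T = h 0"
  proof (rule constant_if_quadratic_increments[where B = "3 * B\<^sup>2"])
    fix a b assume ab: "0 \<le> a" "a \<le> b" "b \<le> T"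
    have "(cmod (F b))\<^sup>2 - (cmod (F a))\<^sup>2 = (cmod (F b - F a))\<^sup>2 + 2 * Re (cnj (F a) * (F b - F a))"
      unfolding cmod_power2 by (simp add: power2_eq_square algebra_simps)
    also have "2 * Re (cnj (F a) * (F b - F a)) = (LINT s:{a..b}|lborel. 2 * Re (cnj (F a) * f s))"
    proof -
      have "Re (cnj (F a) * (LINT s:{a..b}|lborel. f s)) = Re (LINT s:{a..b}|lborel. cnj (F a) * f s)"
        by simp
      also have "\<dots> = (LINT s:{a..b}|lborel. Re (cnj (F a) * f s))"
        unfolding set_lebesgue_integral_def
        by (subst integral_Re[symmetric])
           (use set_integrable_mult_right[OF intf[OF ab(1,3)], of "cnj (F a)"] in \<open>auto simp: set_integrable_def\<close>)
      finally show ?thesis unfolding inc[OF ab] set_integral_mult_right by (rule arg_cong)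
    qed
    finally have e1: "(cmod (F b))\<^sup>2 - (cmod (F a))\<^sup>2
       = (cmod (F b - F a))\<^sup>2 + (LINT s:{a..b}|lborel. 2 * Re (cnj (F a) * f s))" .
    have i1: "set_integrable lborel {a..b} (\<lambda>s. 2 * Re (cnj (F a) * f s))"
    proof (rule set_integrable_bounded_Icc[where B="2 * (cmod (F a) * B)"])
      fix s assume "s \<in> {a..b}"
      then have "\<bar>Re (cnj (F a) * f s)\<bar> \<le> cmod (F a) * B"
        using abs_Re_le_cmod[of "cnj (F a) * f s"] B[of s] ab
        mult_left_mono[of "cmod (f s)" B "cmod (F a)"] by (auto simp: norm_mult)
      then show "norm (2 * Re (cnj (F a) * f s)) \<le> 2 * (cmod (F a) * B)" by simp
    qed measurable
    have e2: "h b - h a = (cmod (F b - F a))\<^sup>2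
        + (LINT s:{a..b}|lborel. 2 * Re (cnj (F a) * f s) - g s)"
      using e1 set_integral_Icc_split[OF intg, of 0 b a] ab i1 intg[of a b]
      by (simp add: h_def)
    have "\<bar>LINT s:{a..b}|lborel. 2 * Re (cnj (F a) * f s) - g s\<bar> \<le> (2 * B\<^sup>2 * (b - a)) * (b - a)"
    proof (rule norm_set_integral_Icc_le[where 'a=real, unfolded real_norm_def])
      fix s assume s: "s \<in> {a..b}"
      have "2 * Re (cnj (F a) * f s) - g s = 2 * Re (cnj (F a - F s) * f s)"
        by (simp add: g_def algebra_simps)
      moreover have "\<bar>Re (cnj (F a - F s) * f s)\<bar> \<le> cmod (F s - F a) * cmod (f s)"
        by (metis abs_Re_le_cmod complex_mod_cnj norm_minus_commute norm_mult)
      moreover have "cmod (F s - F a) * cmod (f s) \<le> (B * (b - a)) * B"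
        using lip[of a s] mult_left_mono[of "s - a" "b - a" B] s ab B[of s] B0
        by (intro mult_mono) auto
      ultimately show "\<bar>2 * Re (cnj (F a) * f s) - g s\<bar> \<le> 2 * B\<^sup>2 * (b - a)"
        by (simp add: power2_eq_square algebra_simps)
    qed (use ab in auto)
    moreover have "(cmod (F b - F a))\<^sup>2 \<le> (B * (b - a))\<^sup>2"
      using lip[OF ab] by (intro power_mono) auto
    moreover have "(2 * B\<^sup>2 * (b - a)) * (b - a) = 2 * (B\<^sup>2 * (b - a)\<^sup>2)" "(B * (b - a))\<^sup>2 = B\<^sup>2 * (b - a)\<^sup>2"
      by (simp_all add: power2_eq_square)
    ultimately show "\<bar>h b - h a\<bar> \<le> 3 * B\<^sup>2 * (b - a)\<^sup>2"
      unfolding e2 using zero_le_power2[of "cmod (F b - F a)"] by linarith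
  qed (rule T)
  moreover have "(LINT s:{0..0}|lborel. g s) = 0" and "F 0 = c"
    using norm_set_integral_Icc_le[of g 0 0 "2 * ((cmod (F 0) + B * T) * B)"] gb T
      norm_set_integral_Icc_le[of f 0 0 B] B F[of 0] by auto
  ultimately show ?thesis by (simp add: h_def g_def)
qed

lemma cis_measurable [measurable (raw)]:
  "f \<in> borel_measurable M \<Longrightarrow> (\<lambda>x. cis (f x)) \<in> borel_measurable M"
  unfolding cis_conv_exp by measurable

lemma weighted_integral_Icc_swap:
  fixes \<phi> :: "real \<Rightarrow> complex" and g :: "real \<Rightarrow> real \<Rightarrow> complex"
  assumes \<phi>: "integrable lborel \<phi>"
    and g [measurable]: "(\<lambda>(s, k). g s k) \<in> borel_measurable (borel \<Otimes>\<^sub>M borel)"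
    and bound: "\<And>s k. s \<in> {0..t} \<Longrightarrow> cmod (g s k) \<le> B"
    and t: "0 \<le> t"
  shows "integrable lborel (\<lambda>k. \<phi> k * (LINT s:{0..t}|lborel. g s k))"
    and "(LINT k|lborel. \<phi> k * (LINT s:{0..t}|lborel. g s k))
      = (LINT s:{0..t}|lborel. (LINT k|lborel. \<phi> k * g s k))"
proof -
  have [measurable]: "\<phi> \<in> borel_measurable borel"
    using borel_measurable_integrable[OF \<phi>] by simp
  have B: "0 \<le> B" using bound[of 0 0] t by (auto intro: order_trans[OF norm_ge_zero])
  define f where "f = (\<lambda>k s. indicator {0..t} s *\<^sub>R (\<phi> k * g s k))"
  have [measurable]: "(\<lambda>(k, s). f k s) \<in> borel_measurable (lborel \<Otimes>\<^sub>M lborel)"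
    unfolding f_def by measurable
  have f_le: "norm (f k s) \<le> indicator {0..t} s * (cmod (\<phi> k) * B)" for k s
    using bound[of s k] by (auto simp: f_def norm_mult split: split_indicator intro: mult_left_mono)
  have int_ind: "integrable lborel (\<lambda>s. indicator {0..t} s * c)" for c :: real
    by (intro integrable_mult_left integrable_real_indicator) (simp_all add: emeasure_lborel_Icc_eq)
  have int_f: "integrable lborel (\<lambda>s. f k s)" for k
    by (rule Bochner_Integration.integrable_bound[OF int_ind[of "cmod (\<phi> k) * B"]])
      (use f_le B in auto)
  have "integrable (lborel \<Otimes>\<^sub>M lborel) (\<lambda>(k, s). f k s)"
  proof (rule lborel_pair.Fubini_integrable)
    show "integrable lborel (\<lambda>k. LINT s|lborel. norm (case (k, s) of (k, s) \<Rightarrow> f k s))"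
    proof (rule Bochner_Integration.integrable_bound)
      show "integrable lborel (\<lambda>k. cmod (\<phi> k) * (B * t))"
        using \<phi> by (intro integrable_mult_left integrable_norm)
      show "AE k in lborel. norm (LINT s|lborel. norm (case (k, s) of (k, s) \<Rightarrow> f k s)) \<le> norm (cmod (\<phi> k) * (B * t))"
      proof (rule AE_I2)
        fix k
        have "(LINT s|lborel. norm (f k s)) \<le> (LINT s|lborel. indicator {0..t} s * (cmod (\<phi> k) * B))"
          by (intro integral_mono integrable_norm int_f int_ind f_le)
        also have "\<dots> = cmod (\<phi> k) * (B * t)" using t by simp
        finally show "norm (LINT s|lborel. norm (case (k, s) of (k, s) \<Rightarrow> f k s)) \<le> norm (cmod (\<phi> k) * (B * t))"
          using B t by simp
      qed
    qed measurable
    show "AE k in lborel. integrable lborel (\<lambda>s. case (k, s) of (k, s) \<Rightarrow> f k s)"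
      using int_f by simp
  qed measurable
  then have int: "integrable (lborel \<Otimes>\<^sub>M lborel) (case_prod f)" by simp
  have inner: "(LINT s|lborel. f k s) = \<phi> k * (LINT s:{0..t}|lborel. g s k)" for k
    unfolding f_def set_lebesgue_integral_def
    by (subst integral_mult_right_zero[symmetric]) (simp add: scaleR_conv_of_real mult_ac)
  show "integrable lborel (\<lambda>k. \<phi> k * (LINT s:{0..t}|lborel. g s k))"
    using lborel_pair.integrable_fst'[OF int] by (simp add: inner)
  show "(LINT k|lborel. \<phi> k * (LINT s:{0..t}|lborel. g s k))
      = (LINT s:{0..t}|lborel. (LINT k|lborel. \<phi> k * g s k))"
    using lborel_pair.Fubini_integral[OF int] unfolding inner
    by (simp add: f_def set_lebesgue_integral_def)
qed

lemma set_integral_Icc_measurable: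
  fixes h :: "'a \<Rightarrow> real \<Rightarrow> complex"
  assumes [measurable]: "(\<lambda>(p, s). h p s) \<in> borel_measurable (M \<Otimes>\<^sub>M borel)"
    and [measurable]: "\<tau> \<in> borel_measurable M"
  shows "(\<lambda>p. LINT s:{0..\<tau> p}|lborel. h p s) \<in> borel_measurable M"
proof -
  have "(\<lambda>(p, s). (if 0 \<le> s \<and> s \<le> \<tau> p then 1 else 0) *\<^sub>R h p s) \<in> borel_measurable (M \<Otimes>\<^sub>M lborel)"
    by measurable
  then have "(\<lambda>p. LINT s|lborel. (if 0 \<le> s \<and> s \<le> \<tau> p then 1 else 0) *\<^sub>R h p s) \<in> borel_measurable M"
    by (rule lborel.borel_measurable_lebesgue_integral)
  moreover have "(\<lambda>p. LINT s|lborel. (if 0 \<le> s \<and> s \<le> \<tau> p then 1 else 0) *\<^sub>R h p s)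
      = (\<lambda>p. LINT s:{0..\<tau> p}|lborel. h p s)"
    unfolding set_lebesgue_integral_def
    by (intro ext Bochner_Integration.integral_cong) (auto simp: indicator_def)
  ultimately show ?thesis by simp
qed


section \<open>Conservation of mass and the pointwise tail bound\<close>

text \<open>
  A regularised form of the weak formulation at one frequency: a Borel coefficient, continuous coordinates and Lebesgue-Borel
  integrals. The solution is extended to negative times as a continuous function, so that its coordinates are Borel
  measurable on the whole line.
\<close>

locale ladder_evolution =
  fixes w :: "real \<Rightarrow> real" and A k :: real and y :: "real \<Rightarrow> nat \<Rightarrow> complex"
  assumes w_measurable [measurable]: "w \<in> borel_measurable borel"
    and w_bound: "\<bar>w s\<bar> \<le> A"
    and square_summable: "0 \<le> t \<Longrightarrow> summable (\<lambda>n. (cmod (y t n))\<^sup>2)"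
    and coordinate_continuous: "continuous_on UNIV (\<lambda>t. y t n)"
    and locally_bounded: "\<exists>K. \<forall>t\<in>{0..T}. \<forall>n. cmod (y t n) \<le> K"
    and duhamel: "0 \<le> t \<Longrightarrow> y t n = free_evol (k * t) delta0 n
      + \<i> * (LINT s:{0..t}|lborel. free_evol (k * (t - s)) (Qop (w s) (y s)) n)"
begin

lemma y_measurable [measurable]: "(\<lambda>t. y t n) \<in> borel_measurable borel"
  by (rule borel_measurable_continuous_onI[OF coordinate_continuous])

lemma Qop_measurable [measurable]: "(\<lambda>s. Qop (w s) (y s) n) \<in> borel_measurable borel"
  unfolding Qop_def by (cases n) simp_all

lemma A_nonneg: "0 \<le> A"
  using w_bound[of 0] by linarith

lemma cmod_Qop_le:
  assumes "\<And>n. cmod (z n) \<le> K"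
  shows "cmod (Qop (w s) z n) \<le> 2 * A * K"
proof -
  have K: "0 \<le> K" using assms[of 0] by (auto intro: order_trans[OF norm_ge_zero])
  have "cmod ((if n = 0 then 0 else z (n - 1)) + z (n + 1)) \<le> K + K"
    using assms K by (intro order_trans[OF norm_triangle_ineq] add_mono) auto
  then have "\<bar>w s\<bar> * cmod ((if n = 0 then 0 else z (n - 1)) + z (n + 1)) \<le> A * (2 * K)"
    using w_bound[of s] A_nonneg by (intro mult_mono) auto
  then show ?thesis unfolding Qop_def norm_mult norm_of_real by (simp only: mult_ac)
qed

lemma local_bound:
  obtains K where "0 \<le> K" "\<And>s n. s \<in> {0..T} \<Longrightarrow> cmod (y s n) \<le> K"
proof -
  obtain K where "\<forall>s\<in>{0..T}. \<forall>n. cmod (y s n) \<le> K" using locally_bounded by blast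
  then show ?thesis by (intro that[of "\<bar>K\<bar>"]) (auto intro: order_trans[OF _ abs_ge_self])
qed

text \<open>
  Undoing the free evolution site by site removes \<open>t\<close> from the integrand, which turns Duhamel's formula into
  an indefinite integral.
\<close>

lemma interaction_picture:
  assumes "0 \<le> t"
  shows "cis (- (k * t * (real n)\<^sup>2)) * y t n = delta0 n
    + (LINT s:{0..t}|lborel. \<i> * (cis (- (k * s * (real n)\<^sup>2)) * Qop (w s) (y s) n))"
proof -
  have 1: "cis (- (k * t * (real n)\<^sup>2)) * free_evol (k * t) delta0 n = delta0 n"
    by (simp add: free_evol_def delta0_def)
  have 2: "free_evol (k * (t - s)) (Qop (w s) (y s)) n
      = cis (k * t * (real n)\<^sup>2) * (cis (- (k * s * (real n)\<^sup>2)) * Qop (w s) (y s) n)" for s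
    by (simp add: free_evol_def cis_mult mult.assoc[symmetric]) (simp add: algebra_simps)
  have "cis (- (k * t * (real n)\<^sup>2)) * (\<i> * (LINT s:{0..t}|lborel. free_evol (k * (t - s)) (Qop (w s) (y s)) n))
    = (cis (- (k * t * (real n)\<^sup>2)) * cis (k * t * (real n)\<^sup>2))
      * (LINT s:{0..t}|lborel. \<i> * (cis (- (k * s * (real n)\<^sup>2)) * Qop (w s) (y s) n))"
    unfolding 2 set_integral_mult_right by (simp only: mult_ac)
  also have "cis (- (k * t * (real n)\<^sup>2)) * cis (k * t * (real n)\<^sup>2) = 1"
    by (simp add: cis_mult)
  finally have "cis (- (k * t * (real n)\<^sup>2)) * (\<i> * (LINT s:{0..t}|lborel. free_evol (k * (t - s)) (Qop (w s) (y s)) n))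
    = (LINT s:{0..t}|lborel. \<i> * (cis (- (k * s * (real n)\<^sup>2)) * Qop (w s) (y s) n))"
    by simp
  with 1 show ?thesis by (subst duhamel[OF assms]) (simp add: distrib_left)
qed

text \<open>
  Up to the factor \<open>w s\<close> this is the rate at which mass flows from site \<open>n + 1\<close> to site \<open>n\<close>.
\<close>

definition current :: "nat \<Rightarrow> real \<Rightarrow> real" where
  "current n s = 2 * Re (\<i> * cnj (y s n) * y s (Suc n))"

definition transfer :: "nat \<Rightarrow> real \<Rightarrow> real" where
  "transfer n t = (LINT s:{0..t}|lborel. w s * current n s)"

lemma current_measurable [measurable]: "current n \<in> borel_measurable borel"
  unfolding current_def by measurable

lemma abs_current_le: "\<bar>current n s\<bar> \<le> 2 * (cmod (y s n) * cmod (y s (Suc n)))"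
  unfolding current_def using abs_Re_le_cmod[of "\<i> * cnj (y s n) * y s (Suc n)"]
  by (simp add: norm_mult)

lemma transfer_integrable: "set_integrable lborel {0..t} (\<lambda>s. w s * current n s)"
proof -
  obtain K where K0: "0 \<le> K" and K: "\<And>s n. s \<in> {0..t} \<Longrightarrow> cmod (y s n) \<le> K"
    using local_bound[of t] by blast
  show ?thesis
  proof (rule set_integrable_bounded_Icc[where B="A * (2 * (K * K))"])
    fix s assume s: "s \<in> {0..t}"
    have "\<bar>current n s\<bar> \<le> 2 * (K * K)"
      using K s K0 by (intro order_trans[OF abs_current_le] mult_left_mono mult_mono) auto
    then show "norm (w s * current n s) \<le> A * (2 * (K * K))"
      using w_bound A_nonneg by (auto simp: abs_mult intro!: mult_mono)
  qed measurable
qed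

text \<open>
  The phases drop out of \<open>|y\<^sub>n|\<^sup>2\<close>, and the two neighbours contribute the currents through the two bonds at \<open>n\<close>; they have
  opposite signs because \<open>Re (i a) = - Re (i cnj a)\<close>.
\<close>

lemma coordinate_mass:
  assumes "0 \<le> t"
  shows "(cmod (y t n))\<^sup>2 = (cmod (delta0 n))\<^sup>2 + transfer n t - (if n = 0 then 0 else transfer (n - 1) t)"
proof -
  define z where "z = (\<lambda>s. cis (- (k * s * (real n)\<^sup>2)) * y s n)"
  define f where "f = (\<lambda>s. \<i> * (cis (- (k * s * (real n)\<^sup>2)) * Qop (w s) (y s) n))"
  obtain K where K0: "0 \<le> K" and K: "\<And>s n. s \<in> {0..t} \<Longrightarrow> cmod (y s n) \<le> K"
    using local_bound[of t] by blast
  have "(cmod (z t))\<^sup>2 = (cmod (delta0 n))\<^sup>2 + (LINT s:{0..t}|lborel. 2 * Re (cnj (z s) * f s))"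
  proof (rule norm_square_indefinite_integral[where B="2 * A * K"])
    show "f \<in> borel_measurable borel" "z \<in> borel_measurable borel"
      unfolding f_def z_def cis_conv_exp by measurable
    show "cmod (f s) \<le> 2 * A * K" if "s \<in> {0..t}" for s
      using K that by (simp add: f_def norm_mult cmod_Qop_le)
    show "z s = delta0 n + (LINT u:{0..s}|lborel. f u)" if "s \<in> {0..t}" for s
      unfolding f_def z_def using interaction_picture[of s n] that by auto
  qed fact
  also have "(\<lambda>s. 2 * Re (cnj (z s) * f s))
    = (\<lambda>s. w s * current n s - (if n = 0 then 0 else w s * current (n - 1) s))"
  proof
    fix s
    have "cnj (z s) * f s = \<i> * cnj (y s n) * Qop (w s) (y s) n * (cis (k * s * (real n)\<^sup>2) * cis (- (k * s * (real n)\<^sup>2)))"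
      by (simp add: z_def f_def cis_cnj)
    also have "\<dots> = \<i> * cnj (y s n) * Qop (w s) (y s) n"
      by (simp add: cis_mult)
    finally show "2 * Re (cnj (z s) * f s)
      = w s * current n s - (if n = 0 then 0 else w s * current (n - 1) s)"
      by (cases n) (simp_all add: Qop_def current_def algebra_simps)
  qed
  finally show ?thesis
    using transfer_integrable[of t n] transfer_integrable[of t "n - 1"]
    by (simp add: z_def norm_mult transfer_def set_integral_diff split: if_splits)
qed

lemma partial_mass:
  assumes "0 \<le> t"
  shows "(\<Sum>n\<le>m. (cmod (y t n))\<^sup>2) = 1 + transfer m t"
proof (induction m)
  case 0
  show ?case using coordinate_mass[OF assms, of 0] by (simp add: delta0_def)
next
  case (Suc m)
  then show ?case using coordinate_mass[OF assms, of "Suc m"] by (simp add: delta0_def)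
qed

text \<open>
  Square summability makes the current through distant bonds vanish at every time, and the local bound dominates it: no mass
  escapes to infinity.
\<close>

lemma transfer_tendsto_zero:
  assumes "0 \<le> t"
  shows "(\<lambda>m. transfer m t) \<longlonglongrightarrow> 0"
proof -
  obtain K where K0: "0 \<le> K" and K: "\<And>s n. s \<in> {0..t} \<Longrightarrow> cmod (y s n) \<le> K"
    using local_bound[of t] by blast
  have "(\<lambda>m. transfer m t) \<longlonglongrightarrow> (LINT s:{0..t}|lborel. 0)"
    unfolding transfer_def set_lebesgue_integral_def
  proof (rule integral_dominated_convergence[where w="\<lambda>s. indicator {0..t} s *\<^sub>R (A * (2 * (K * K)))"])
    show "integrable lborel (\<lambda>s. indicator {0..t} s *\<^sub>R (A * (2 * (K * K))))"
      by (intro integrable_scaleR_left integrable_real_indicator) (simp_all add: emeasure_lborel_Icc_eq)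
    show "AE s in lborel. (\<lambda>m. indicator {0..t} s *\<^sub>R (w s * current m s)) \<longlonglongrightarrow> indicator {0..t} s *\<^sub>R 0"
    proof (rule AE_I2)
      fix s
      have "(\<lambda>m. w s * current m s) \<longlonglongrightarrow> 0" if s: "s \<in> {0..t}"
      proof -
        have "(\<lambda>n. (cmod (y s n))\<^sup>2) \<longlonglongrightarrow> 0"
          using square_summable[of s] s by (intro summable_LIMSEQ_zero) auto
        then have "(\<lambda>n. sqrt ((cmod (y s n))\<^sup>2)) \<longlonglongrightarrow> sqrt 0" by (rule tendsto_real_sqrt)
        then have c0: "(\<lambda>n. cmod (y s n)) \<longlonglongrightarrow> 0" by simp
        have "(\<lambda>n. 2 * (cmod (y s n) * cmod (y s (Suc n)))) \<longlonglongrightarrow> 2 * (0 * 0)"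
          by (intro tendsto_mult tendsto_const c0 LIMSEQ_Suc[OF c0])
        then have lim0: "(\<lambda>n. 2 * (cmod (y s n) * cmod (y s (Suc n)))) \<longlonglongrightarrow> 0" by simp
        have "(\<lambda>m. current m s) \<longlonglongrightarrow> 0"
          by (rule Lim_null_comparison[OF _ lim0]) (simp add: abs_current_le)
        then show ?thesis by (rule tendsto_mult_right_zero)
      qed
      then show "(\<lambda>m. indicator {0..t} s *\<^sub>R (w s * current m s)) \<longlonglongrightarrow> indicator {0..t} s *\<^sub>R 0"
        by (cases "s \<in> {0..t}") auto
    qed
    show "AE s in lborel. norm (indicator {0..t} s *\<^sub>R (w s * current m s)) \<le> indicator {0..t} s *\<^sub>R (A * (2 * (K * K)))" for m
    proof (rule AE_I2)
      fix s
      have "\<bar>w s * current m s\<bar> \<le> A * (2 * (K * K))" if s: "s \<in> {0..t}"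
      proof -
        have "\<bar>current m s\<bar> \<le> 2 * (K * K)"
          using K s K0 by (intro order_trans[OF abs_current_le] mult_left_mono mult_mono) auto
        then show ?thesis using w_bound A_nonneg by (auto simp: abs_mult intro!: mult_mono)
      qed
      then show "norm (indicator {0..t} s *\<^sub>R (w s * current m s)) \<le> indicator {0..t} s *\<^sub>R (A * (2 * (K * K)))"
        by (cases "s \<in> {0..t}") auto
    qed
  qed measurable
  then show ?thesis by simp
qed

lemma mass_conservation:
  assumes "0 \<le> t"
  shows "(\<lambda>n. (cmod (y t n))\<^sup>2) sums 1"
proof -
  have "(\<lambda>m. \<Sum>n\<le>m. (cmod (y t n))\<^sup>2) \<longlonglongrightarrow> 1 + 0"
    unfolding partial_mass[OF assms] by (intro tendsto_add tendsto_const transfer_tendsto_zero assms)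
  then show ?thesis by (simp add: sums_def_le)
qed

lemma cmod_le_1:
  assumes "0 \<le> t"
  shows "cmod (y t n) \<le> 1"
proof -
  have "(\<Sum>i\<in>{n}. (cmod (y t i))\<^sup>2) \<le> 1"
    using sum_le_suminf[OF square_summable[OF assms], of "{n}"] sums_unique[OF mass_conservation[OF assms]] by simp
  then show ?thesis using power2_le_imp_le[of "cmod (y t n)" 1] by simp
qed

lemma tail_mass_eq:
  assumes "0 \<le> t"
  shows "tail_mass N (y t) = 1 - (\<Sum>n<N. (cmod (y t n))\<^sup>2)"
  unfolding tail_mass_def
  using suminf_split_initial_segment[OF square_summable[OF assms], of N]
    sums_unique[OF mass_conservation[OF assms]] by (simp add: add.commute)

text \<open>
  By conservation, the mass beyond site \<open>m\<close> is exactly what has crossed the bond between \<open>m\<close> and \<open>m + 1\<close>.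
\<close>

lemma tail_mass_Suc_eq:
  assumes "0 \<le> t"
  shows "tail_mass (Suc m) (y t) = - transfer m t"
  using partial_mass[OF assms, of m] by (simp add: tail_mass_eq[OF assms] lessThan_Suc_atMost)

lemma tail_mass_nonneg: "0 \<le> t \<Longrightarrow> 0 \<le> tail_mass N (y t)"
  unfolding tail_mass_def using summable_ignore_initial_segment[OF square_summable[of t], of N]
  by (intro suminf_nonneg) (simp_all add: add.commute)

lemma tail_mass_diff: 
  assumes "0 \<le> t"
  shows "tail_mass N (y t) = tail_mass (Suc N) (y t) + (cmod (y t N))\<^sup>2"
  by (simp add: tail_mass_eq[OF assms])

lemma tail_mass_antimono:
  assumes "0 \<le> t" "M \<le> N"
  shows "tail_mass N (y t) \<le> tail_mass M (y t)"
  using assms(2)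
proof (induction rule: dec_induct)
  case (step n)
  then show ?case using tail_mass_diff[OF assms(1), of n] zero_le_power2[of "cmod (y t n)"] by linarith
qed simp

text \<open>
  Summation by parts shows that this is \<open>\<Sum>n. min(n, N)\<^sup>2 |y\<^sub>n|\<^sup>2\<close>. Written through the tails it is a finite sum, each
  term of which is a single integral over time.
\<close>

definition energy :: "nat \<Rightarrow> real \<Rightarrow> real" where
  "energy N t = (\<Sum>m<N. (2 * real m + 1) * tail_mass (Suc m) (y t))"

lemma energy_nonneg: "0 \<le> t \<Longrightarrow> 0 \<le> energy N t"
  unfolding energy_def by (intro sum_nonneg mult_nonneg_nonneg tail_mass_nonneg) auto

lemma tail_mass_le_energy:
  assumes "0 \<le> t"
  shows "(real N)\<^sup>2 * tail_mass N (y t) \<le> energy N t"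
proof -
  have "(real N)\<^sup>2 = (\<Sum>m<N. 2 * real m + 1)"
    by (induction N) (simp_all add: power2_eq_square algebra_simps)
  then have "(real N)\<^sup>2 * tail_mass N (y t) = (\<Sum>m<N. (2 * real m + 1) * tail_mass N (y t))"
    by (simp add: sum_distrib_right)
  also have "\<dots> \<le> energy N t"
    unfolding energy_def using tail_mass_antimono[OF assms] by (intro sum_mono mult_left_mono) auto
  finally show ?thesis .
qed

lemma weighted_mass_le_energy:
  assumes "0 \<le> t"
  shows "(\<Sum>m<N. (real (Suc m))\<^sup>2 * (cmod (y t (Suc m)))\<^sup>2) \<le> energy N t"
proof -
  have "(\<Sum>m<N. (real (Suc m))\<^sup>2 * (cmod (y t (Suc m)))\<^sup>2) = energy N t - (real N)\<^sup>2 * tail_mass (Suc N) (y t)"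
  proof (induction N)
    case (Suc N)
    then show ?case using tail_mass_diff[OF assms, of "Suc N"]
      by (simp add: energy_def power2_eq_square algebra_simps)
  qed (simp add: energy_def)
  then show ?thesis using tail_mass_nonneg[OF assms] by simp
qed

text \<open>
  Cauchy-Schwarz, splitting \<open>2m + 1 \<le> 2(m + 1)\<close> so that the weight falls on \<open>y\<^sub>m\<^sub>+\<^sub>1\<close> and the other factor is
  bounded by the total mass.
\<close>

lemma sum_current_le:
  assumes "0 \<le> s"
  shows "(\<Sum>m<N. (2 * real m + 1) * \<bar>current m s\<bar>) \<le> 4 * sqrt (energy N s)"
proof -
  have "(\<Sum>m<N. (2 * real m + 1) * \<bar>current m s\<bar>)
     \<le> (\<Sum>m<N. 4 * (cmod (y s m) * (real (Suc m) * cmod (y s (Suc m)))))"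
  proof (rule sum_mono)
    fix m
    have "(2 * real m + 1) * \<bar>current m s\<bar> \<le> (2 * real (Suc m)) * (2 * (cmod (y s m) * cmod (y s (Suc m))))"
      by (intro mult_mono abs_current_le) auto
    then show "(2 * real m + 1) * \<bar>current m s\<bar> \<le> 4 * (cmod (y s m) * (real (Suc m) * cmod (y s (Suc m))))"
      by (simp add: field_simps)
  qed
  also have "\<dots> = 4 * (\<Sum>m<N. \<bar>cmod (y s m)\<bar> * \<bar>real (Suc m) * cmod (y s (Suc m))\<bar>)"
    by (simp add: sum_distrib_left)
  also have "\<dots> \<le> 4 * (L2_set (\<lambda>m. cmod (y s m)) {..<N} * L2_set (\<lambda>m. real (Suc m) * cmod (y s (Suc m))) {..<N})"
    by (intro mult_left_mono L2_set_mult_ineq) auto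
  also have "\<dots> \<le> 4 * (1 * sqrt (energy N s))"
  proof (intro mult_left_mono mult_mono)
    have "(\<Sum>m<N. (cmod (y s m))\<^sup>2) \<le> 1"
      using tail_mass_nonneg[OF assms, of N] tail_mass_eq[OF assms, of N] by simp
    then show "L2_set (\<lambda>m. cmod (y s m)) {..<N} \<le> 1" by (simp add: L2_set_def)
    show "L2_set (\<lambda>m. real (Suc m) * cmod (y s (Suc m))) {..<N} \<le> sqrt (energy N s)"
      using weighted_mass_le_energy[OF assms, of N] by (simp add: L2_set_def power_mult_distrib)
  qed (auto simp: energy_nonneg assms L2_set_nonneg)
  finally show ?thesis by simp
qed

text \<open>
  The bound \<open>E(r) \<le> 4 \<integral>|w| E\<^bsup>1/2\<^esup> \<le> 4 b\<^bsup>1/2\<^esup> \<integral>|w|\<close> holds for all \<open>r \<le> t\<close>, where \<open>b\<close> is the supremum of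
  \<open>E\<close>; it applies to \<open>b\<close> itself and can be divided by \<open>b\<^bsup>1/2\<^esup>\<close>.
\<close>

lemma energy_le:
  assumes "0 \<le> t"
  shows "energy N t \<le> 16 * (LINT s:{0..t}|lborel. \<bar>w s\<bar>)\<^sup>2"
proof -
  define W where "W = (LINT s:{0..t}|lborel. \<bar>w s\<bar>)"
  have int_w: "set_integrable lborel {0..r} (\<lambda>s. \<bar>w s\<bar>)" for r
    using w_bound by (intro set_integrable_bounded_Icc[where B=A]) auto
  have bdd: "bdd_above (energy N ` {0..t})"
  proof (rule bdd_aboveI2)
    fix s assume "s \<in> {0..t}"
    then show "energy N s \<le> (\<Sum>m<N. (2 * real m + 1) * 1)"
      unfolding energy_def
      by (intro sum_mono mult_left_mono) (auto simp: tail_mass_eq simp del: sum.lessThan_Suc intro: sum_nonneg)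
  qed
  define b where "b = (SUP s\<in>{0..t}. energy N s)"
  have le_b: "energy N s \<le> b" if "s \<in> {0..t}" for s
    unfolding b_def using that bdd by (rule cSUP_upper)
  have b0: "0 \<le> b" using le_b[of t] energy_nonneg[of t N] assms by auto
  have "energy N r \<le> 4 * sqrt b * W" if r: "r \<in> {0..t}" for r
  proof -
    have r0: "0 \<le> r" using r by simp
    have int_summand: "integrable lborel (\<lambda>s. indicator {0..r} s *\<^sub>R ((2 * real m + 1) * (- (w s * current m s))))" for m
      using set_integrable_mult_right[OF transfer_integrable[of r m], of "- (2 * real m + 1)"]
      unfolding set_integrable_def by (rule back_subst[of "integrable lborel"]) (auto simp: algebra_simps)
    have "energy N r = (\<Sum>m<N. (2 * real m + 1) * (LINT s:{0..r}|lborel. - (w s * current m s)))"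
      unfolding energy_def tail_mass_Suc_eq[OF r0] transfer_def
      by (simp add: set_integral_uminus[OF transfer_integrable])
    also have "\<dots> = (LINT s:{0..r}|lborel. (\<Sum>m<N. (2 * real m + 1) * (- (w s * current m s))))"
    proof -
      have "(LINT s:{0..r}|lborel. (\<Sum>m<N. (2 * real m + 1) * (- (w s * current m s))))
        = (\<Sum>m<N. LINT s:{0..r}|lborel. (2 * real m + 1) * (- (w s * current m s)))"
        unfolding set_lebesgue_integral_def scaleR_sum_right
        by (intro Bochner_Integration.integral_sum int_summand)
      then show ?thesis by (simp only: set_integral_mult_right)
    qed
    also have "\<dots> \<le> (LINT s:{0..r}|lborel. \<bar>w s\<bar> * (4 * sqrt b))"
    proof (rule set_integral_mono)
      show "set_integrable lborel {0..r} (\<lambda>s. (\<Sum>m<N. (2 * real m + 1) * (- (w s * current m s))))"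
        unfolding set_integrable_def scaleR_sum_right
        by (intro Bochner_Integration.integrable_sum int_summand)
      show "set_integrable lborel {0..r} (\<lambda>s. \<bar>w s\<bar> * (4 * sqrt b))"
        using int_w by simp
      fix s assume s: "s \<in> {0..r}"
      have "(\<Sum>m<N. (2 * real m + 1) * (- (w s * current m s)))
         \<le> (\<Sum>m<N. \<bar>w s\<bar> * ((2 * real m + 1) * \<bar>current m s\<bar>))"
      proof (rule sum_mono)
        fix m
        have "- (w s * current m s) \<le> \<bar>w s\<bar> * \<bar>current m s\<bar>"
          by (metis abs_ge_minus_self abs_mult)
        then have "(2 * real m + 1) * (- (w s * current m s)) \<le> (2 * real m + 1) * (\<bar>w s\<bar> * \<bar>current m s\<bar>)"
          by (intro mult_left_mono) auto
        then show "(2 * real m + 1) * (- (w s * current m s)) \<le> \<bar>w s\<bar> * ((2 * real m + 1) * \<bar>current m s\<bar>)"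
          by (simp only: mult_ac)
      qed
      also have "\<dots> \<le> \<bar>w s\<bar> * (4 * sqrt (energy N s))"
        unfolding sum_distrib_left[symmetric] using s by (intro mult_left_mono sum_current_le) auto
      also have "\<dots> \<le> \<bar>w s\<bar> * (4 * sqrt b)"
        using le_b[of s] s r by (intro mult_left_mono) auto
      finally show "(\<Sum>m<N. (2 * real m + 1) * (- (w s * current m s))) \<le> \<bar>w s\<bar> * (4 * sqrt b)" .
    qed
    also have "\<dots> = (LINT s:{0..r}|lborel. \<bar>w s\<bar>) * (4 * sqrt b)" by simp
    also have "\<dots> \<le> W * (4 * sqrt b)"
    proof (rule mult_right_mono)
      show "(LINT s:{0..r}|lborel. \<bar>w s\<bar>) \<le> W"
        unfolding W_def set_lebesgue_integral_def
        using int_w r by (intro integral_mono) (auto simp: set_integrable_def split: split_indicator)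
    qed (use b0 in simp)
    finally show ?thesis by (simp add: mult.commute)
  qed
  then have "b \<le> 4 * sqrt b * W"
    unfolding b_def using assms by (intro cSUP_least) auto
  then have "sqrt b * sqrt b \<le> 4 * W * sqrt b" using b0 by (simp add: mult_ac)
  moreover have "0 \<le> W" unfolding W_def set_lebesgue_integral_def by simp
  ultimately have "sqrt b \<le> 4 * W"
    using b0 by (cases "b = 0") (auto simp del: real_sqrt_mult_self)
  then have "(sqrt b)\<^sup>2 \<le> (4 * W)\<^sup>2" using b0 by (intro power_mono) auto
  then have "b \<le> 16 * W\<^sup>2" using b0 by (simp add: power_mult_distrib)
  then show ?thesis using le_b[of t] assms by (simp add: W_def)
qed

lemma tail_mass_le:
  assumes "0 \<le> t" "0 < N"
  shows "tail_mass N (y t) \<le> 16 * (LINT s:{0..t}|lborel. \<bar>w s\<bar>)\<^sup>2 / (real N)\<^sup>2"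
  using order_trans[OF tail_mass_le_energy[OF assms(1), of N] energy_le[OF assms(1), of N]] assms(2)
  by (simp add: field_simps)

end

section \<open>Picard iteration and one-sided spectrum\<close>

primrec picard :: "(real \<Rightarrow> real) \<Rightarrow> nat \<Rightarrow> real \<Rightarrow> real \<Rightarrow> nat \<Rightarrow> complex" where
  "picard w 0 t k n = 0"
| "picard w (Suc m) t k n = free_evol (k * t) delta0 n
     + \<i> * (LINT s:{0..t}|lborel. free_evol (k * (t - s)) (Qop (w s) (picard w m s k)) n)"

lemma picard_measurable:
  assumes [measurable]: "w \<in> borel_measurable borel"
  shows "(\<lambda>(t, k). picard w m t k n) \<in> borel_measurable (borel \<Otimes>\<^sub>M borel)"
proof (induction m arbitrary: n)
  case 0
  show ?case by simp
next
  case (Suc m)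
  note Suc.IH [measurable]
  have [measurable]: "(\<lambda>(p, s). free_evol (snd p * (fst p - s)) (Qop (w s) (picard w m s (snd p))) n)
      \<in> borel_measurable ((borel \<Otimes>\<^sub>M borel) \<Otimes>\<^sub>M borel)"
    unfolding free_evol_def Qop_def by (cases n) simp_all
  have "(\<lambda>p. LINT s:{0..fst p}|lborel. free_evol (snd p * (fst p - s)) (Qop (w s) (picard w m s (snd p))) n)
      \<in> borel_measurable (borel \<Otimes>\<^sub>M borel)"
    by (rule set_integral_Icc_measurable) measurable
  then show ?case
    unfolding picard.simps by (simp add: case_prod_beta free_evol_def)
qed

text \<open>
  Solutions for all frequencies with one coefficient. Being constant in the past makes joint measurability in time and
  frequency a statement about the whole plane.
\<close>

locale ladder_family =
  fixes w :: "real \<Rightarrow> real" and A :: real and x :: "real \<Rightarrow> real \<Rightarrow> nat \<Rightarrow> complex"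
  assumes evolution: "ladder_evolution w A k (\<lambda>t. x t k)"
    and past_constant: "t \<le> 0 \<Longrightarrow> x t k = x 0 k"
begin

lemma w_measurable [measurable]: "w \<in> borel_measurable borel"
  using ladder_evolution.w_measurable[OF evolution] .

lemma w_bound: "\<bar>w s\<bar> \<le> A"
  using ladder_evolution.w_bound[OF evolution] .

lemma A_nonneg: "0 \<le> A"
  using ladder_evolution.A_nonneg[OF evolution] .

lemma picard_joint [measurable]: "(\<lambda>(t, k). picard w m t k n) \<in> borel_measurable (borel \<Otimes>\<^sub>M borel)"
  by (rule picard_measurable) measurable

lemma cmod_x_le_1: "cmod (x t k n) \<le> 1"
proof (cases "0 \<le> t")
  case True
  then show ?thesis by (rule ladder_evolution.cmod_le_1[OF evolution])
next
  case False
  then show ?thesis using past_constant[of t k] ladder_evolution.cmod_le_1[OF evolution, of 0] by simp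
qed

lemma free_evol_Qop_diff:
  "free_evol a (Qop b z) n - free_evol a (Qop b z') n = free_evol a (Qop b (\<lambda>n. z n - z' n)) n"
  by (cases n) (simp_all add: free_evol_def Qop_def algebra_simps)

lemma cmod_free_evol_Qop_le:
  assumes "\<And>n. cmod (z n) \<le> K"
  shows "cmod (free_evol a (Qop (w s) z) n) \<le> 2 * A * K"
  using ladder_evolution.cmod_Qop_le[OF evolution assms] by (simp add: free_evol_def norm_mult)

lemma x_measurable_time [measurable]: "(\<lambda>t. x t k n) \<in> borel_measurable borel"
  using ladder_evolution.y_measurable[OF evolution] .

text \<open>
  The usual factorial estimate, in the supremum norm over the sites. It starts from \<open>|x\<^sub>n| \<le> 1\<close>, which mass conservation
  provides, and is uniform in \<open>k\<close> because the free evolution only rotates phases.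
\<close>

lemma picard_error:
  assumes "0 \<le> t"
  shows "cmod (x t k n - picard w m t k n) \<le> (2 * A * t) ^ m / fact m"
  using assms
proof (induction m arbitrary: t n)
  case 0
  show ?case using cmod_x_le_1 by simp
next
  case (Suc m)
  define e where "e = (\<lambda>s n. x s k n - picard w m s k n)"
  have [measurable]: "(\<lambda>s. e s n) \<in> borel_measurable borel" for n
    unfolding e_def by measurable
  have [measurable]: "(\<lambda>s. free_evol (k * (t - s)) (Qop (w s) (e s)) n) \<in> borel_measurable borel"
    unfolding free_evol_def Qop_def by (cases n) simp_all
  have [measurable]: "(\<lambda>s. free_evol (k * (t - s)) (Qop (w s) (x s k)) n) \<in> borel_measurable borel"
    unfolding free_evol_def Qop_def by (cases n) simp_all
  define R where "R = (\<lambda>s. 2 * A * ((2 * A * s) ^ m / fact m))"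
  have R_mono: "R s \<le> R t" if "s \<in> {0..t}" for s
    unfolding R_def using that A_nonneg by (intro mult_left_mono divide_right_mono power_mono) auto
  have bound: "cmod (free_evol (k * (t - s)) (Qop (w s) (e s)) n) \<le> R s" if "s \<in> {0..t}" for s
    unfolding R_def e_def using that Suc.IH by (intro cmod_free_evol_Qop_le) auto
  have int_e: "set_integrable lborel {0..t} (\<lambda>s. free_evol (k * (t - s)) (Qop (w s) (e s)) n)"
    by (rule set_integrable_bounded_Icc[where B="R t"]) (use bound R_mono in \<open>auto intro: order_trans\<close>)
  have int_x: "set_integrable lborel {0..t} (\<lambda>s. free_evol (k * (t - s)) (Qop (w s) (x s k)) n)"
    by (rule set_integrable_bounded_Icc[where B="2 * A * 1"]) (use cmod_x_le_1 in \<open>auto intro: cmod_free_evol_Qop_le[where K=1, simplified]\<close>)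
  have split: "free_evol (k * (t - s)) (Qop (w s) (picard w m s k)) n
    = free_evol (k * (t - s)) (Qop (w s) (x s k)) n - free_evol (k * (t - s)) (Qop (w s) (e s)) n" for s
    unfolding free_evol_Qop_diff by (simp add: e_def)
  have "x t k n - picard w (Suc m) t k n
     = \<i> * (LINT s:{0..t}|lborel. free_evol (k * (t - s)) (Qop (w s) (e s)) n)"
    unfolding picard.simps split set_integral_diff(2)[OF int_x int_e]
      ladder_evolution.duhamel[OF evolution Suc.prems, of k n]
    by (simp add: algebra_simps)
  then have "cmod (x t k n - picard w (Suc m) t k n)
     \<le> (LINT s:{0..t}|lborel. cmod (free_evol (k * (t - s)) (Qop (w s) (e s)) n))"
    using set_integral_norm_bound[OF int_e] by (simp add: norm_mult)
  also have "\<dots> \<le> (LINT s:{0..t}|lborel. R s)"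
  proof (intro set_integral_mono set_integrable_norm int_e bound)
    show "set_integrable lborel {0..t} R"
      unfolding R_def by (rule borel_integrable_atLeastAtMost') (intro continuous_intros, simp)
  qed
  also have "(LINT s:{0..t}|lborel. R s) = (LINT s|lborel. (2 * A) ^ Suc m / fact m * (s ^ m * indicator {0..t} s))"
    unfolding set_lebesgue_integral_def R_def
    by (intro Bochner_Integration.integral_cong) (auto simp: power_mult_distrib)
  also have "\<dots> = (2 * A) ^ Suc m / fact m * (t ^ Suc m / Suc m)"
    using integral_power[OF Suc.prems, of m] by simp
  also have "\<dots> = (2 * A * t) ^ Suc m / fact (Suc m)"
    by (simp add: power_mult_distrib fact_Suc field_simps del: of_nat_Suc)
  finally show ?case .
qed

lemma picard_tendsto:
  assumes "0 \<le> t"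
  shows "(\<lambda>m. picard w m t k n) \<longlonglongrightarrow> x t k n"
proof -
  have "(\<lambda>m. (2 * A * t) ^ m / fact m) \<longlonglongrightarrow> 0"
    using summable_LIMSEQ_zero[OF summable_exp[of "2 * A * t"]] by (simp add: field_simps)
  then have "(\<lambda>m. x t k n - picard w m t k n) \<longlonglongrightarrow> 0"
    by (rule Lim_null_comparison[rotated]) (simp add: picard_error[OF assms])
  then show ?thesis
    using tendsto_diff[OF tendsto_const[of "x t k n"]] by fastforce
qed

text \<open>
  The solution is given separately for each frequency; measurability in \<open>k\<close> comes from uniqueness, that is, from being the
  limit of the explicit iterates.
\<close>

lemma x_joint [measurable]: "(\<lambda>(t, k). x t k n) \<in> borel_measurable (borel \<Otimes>\<^sub>M borel)"
proof (rule borel_measurable_LIMSEQ_metric)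
  fix p :: "real \<times> real"
  \<comment> \<open>Picard iterates approximate the solution at nonnegative times; \<open>past_constant\<close> reduces to these.\<close>
  have "x (max 0 (fst p)) (snd p) n = x (fst p) (snd p) n"
    by (metis max_def past_constant nle_le)
  then show "(\<lambda>m. case p of (t, k) \<Rightarrow> picard w m (max 0 t) k n) \<longlonglongrightarrow> (case p of (t, k) \<Rightarrow> x t k n)"
    using picard_tendsto[of "max 0 (fst p)" "snd p" n] by (simp add: case_prod_beta)
qed measurable

lemma x_measurable_frequency [measurable]: "(\<lambda>k. x t k n) \<in> borel_measurable borel"
  by measurable

text \<open>
  One-sided spectrum of the solution: a weight \<open>\<phi>\<close> annihilating the characters \<open>e\<^bsup>ik\<sigma>\<^esup>\<close> with \<open>\<sigma> \<ge> \<epsilon>\<close> also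
  annihilates their products with \<open>x\<^sub>n(t,\<cdot>)\<close>. Each Picard step multiplies by phases with nonnegative time
  delay \<open>(t - s) n\<^sup>2\<close>, which only increases \<open>\<sigma>\<close>, so the property is inherited by all iterates and by their bounded limit.
\<close>

lemma fourier_vanishes:
  assumes \<phi>: "integrable lborel \<phi>"
    and vanish: "\<And>\<sigma>. \<epsilon> \<le> \<sigma> \<Longrightarrow> (LINT k|lborel. \<phi> k * cis (k * \<sigma>)) = 0"
    and "\<epsilon> \<le> \<sigma>" "0 \<le> t"
  shows "(LINT k|lborel. \<phi> k * cis (k * \<sigma>) * x t k n) = 0"
proof -
  have [measurable]: "\<phi> \<in> borel_measurable borel"
    using borel_measurable_integrable[OF \<phi>] by simp
  have phase: "integrable lborel (\<lambda>k. \<phi> k * cis (k * \<sigma>))" for \<sigma>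
    by (rule Bochner_Integration.integrable_bound[OF \<phi>]) (auto simp: norm_mult)
  have picard_bound: "cmod (picard w m s k n) \<le> 1 + (2 * A * t) ^ m / fact m" if "s \<in> {0..t}" for m s k n t
  proof -
    have "cmod (picard w m s k n) \<le> cmod (x s k n) + cmod (x s k n - picard w m s k n)"
      by (metis norm_triangle_sub norm_minus_commute)
    also have "\<dots> \<le> 1 + (2 * A * s) ^ m / fact m"
      using that by (intro add_mono cmod_x_le_1 picard_error) auto
    also have "\<dots> \<le> 1 + (2 * A * t) ^ m / fact m"
      using that A_nonneg by (intro add_left_mono divide_right_mono power_mono mult_left_mono) auto
    finally show ?thesis .
  qed
  have integrable_picard: "integrable lborel (\<lambda>k. \<phi> k * cis (k * \<sigma>) * picard w m s k n)"
    if "0 \<le> s" for m s n \<sigma>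
  proof (rule Bochner_Integration.integrable_bound)
    show "integrable lborel (\<lambda>k. \<phi> k * complex_of_real (1 + (2 * A * s) ^ m / fact m))"
      using \<phi> by (rule integrable_mult_left)
    show "AE k in lborel. norm (\<phi> k * cis (k * \<sigma>) * picard w m s k n)
       \<le> norm (\<phi> k * complex_of_real (1 + (2 * A * s) ^ m / fact m))"
    proof (rule AE_I2)
      fix k
      have "cmod (picard w m s k n) \<le> \<bar>1 + (2 * A * s) ^ m / fact m\<bar>"
        using picard_bound[of s s m k n] that by auto
      then show "norm (\<phi> k * cis (k * \<sigma>) * picard w m s k n)
        \<le> norm (\<phi> k * complex_of_real (1 + (2 * A * s) ^ m / fact m))"
        unfolding norm_mult norm_of_real by (simp add: mult_left_mono)
    qed
  qed measurable
  have vanish_picard: "(LINT k|lborel. \<phi> k * cis (k * \<sigma>) * picard w m t k n) = 0"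
    if "\<epsilon> \<le> \<sigma>" "0 \<le> t" for m t n \<sigma>
    using that
  proof (induction m arbitrary: t n \<sigma>)
    case 0
    show ?case by simp
  next
    case (Suc m)
    define g where "g = (\<lambda>s k. free_evol (k * (t - s)) (Qop (w s) (picard w m s k)) n)"
    have [measurable]: "(\<lambda>(s, k). g s k) \<in> borel_measurable (borel \<Otimes>\<^sub>M borel)"
      unfolding g_def free_evol_def Qop_def by (cases n) simp_all
    have g_bound: "cmod (g s k) \<le> 2 * A * (1 + (2 * A * t) ^ m / fact m)" if "s \<in> {0..t}" for s k
      unfolding g_def using that by (intro cmod_free_evol_Qop_le picard_bound)
    have zero: "(LINT k|lborel. \<phi> k * cis (k * \<sigma>) * g s k) = 0" if s: "s \<in> {0..t}" for s
    proof -
      \<comment> \<open>The delay accumulated between the times \<open>s\<close> and \<open>t\<close> at site \<open>n\<close>.\<close>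
      define \<sigma>' where "\<sigma>' = \<sigma> + (t - s) * (real n)\<^sup>2"
      have \<sigma>': "\<epsilon> \<le> \<sigma>'" using s Suc.prems(1) unfolding \<sigma>'_def by (auto intro: order_trans)
      have z: "(LINT k|lborel. \<phi> k * cis (k * \<sigma>') * picard w m s k j) = 0"
         and i: "integrable lborel (\<lambda>k. \<phi> k * cis (k * \<sigma>') * picard w m s k j)" for j
        using Suc.IH[OF \<sigma>'] integrable_picard s by auto
      have eq: "\<phi> k * cis (k * \<sigma>) * g s k = complex_of_real (w s) *
         ((if n = 0 then 0 else \<phi> k * cis (k * \<sigma>') * picard w m s k (n - 1))
           + \<phi> k * cis (k * \<sigma>') * picard w m s k (n + 1))" for k
      proof -
        have "cis (k * \<sigma>') = cis (k * \<sigma>) * cis (k * (t - s) * (real n)\<^sup>2)"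
          by (simp add: cis_mult \<sigma>'_def algebra_simps)
        then show ?thesis by (simp add: g_def free_evol_def Qop_def algebra_simps)
      qed
      show ?thesis unfolding eq using z i by (cases n) simp_all
    qed
    have "\<phi> k * cis (k * \<sigma>) * picard w (Suc m) t k n
      = \<phi> k * cis (k * (\<sigma> + t * (real n)\<^sup>2)) * delta0 n
        + \<i> * (\<phi> k * cis (k * \<sigma>) * (LINT s:{0..t}|lborel. g s k))" for k
      by (simp add: g_def free_evol_def cis_mult[symmetric] algebra_simps)
    moreover have "(LINT k|lborel. \<phi> k * cis (k * (\<sigma> + t * (real n)\<^sup>2))) = 0"
      using Suc.prems by (intro vanish) (auto intro: order_trans)
    moreover have "(LINT k|lborel. \<phi> k * cis (k * \<sigma>) * (LINT s:{0..t}|lborel. g s k)) = 0"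
    proof -
      have "(LINT k|lborel. \<phi> k * cis (k * \<sigma>) * (LINT s:{0..t}|lborel. g s k))
        = (LINT s:{0..t}|lborel. (LINT k|lborel. \<phi> k * cis (k * \<sigma>) * g s k))"
        using g_bound Suc.prems(2) by (intro weighted_integral_Icc_swap(2) phase) auto
      also have "\<dots> = (LINT s:{0..t}|lborel. 0)"
        unfolding set_lebesgue_integral_def using zero
        by (intro Bochner_Integration.integral_cong) (auto simp: indicator_def)
      finally show ?thesis by simp
    qed
    moreover have "integrable lborel (\<lambda>k. \<phi> k * cis (k * \<sigma>) * (LINT s:{0..t}|lborel. g s k))"
      using g_bound Suc.prems(2) by (intro weighted_integral_Icc_swap(1) phase) auto
    ultimately show ?case
      using phase by simp
  qed
  \<comment> \<open>The \<open>m\<close>-th Picard error is a term of the exponential series, so this bounds all iterates at once.\<close>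
  define E where "E = 1 + exp (2 * A * t)"
  have "(\<lambda>m. LINT k|lborel. \<phi> k * cis (k * \<sigma>) * picard w m t k n)
     \<longlonglongrightarrow> (LINT k|lborel. \<phi> k * cis (k * \<sigma>) * x t k n)"
  proof (rule integral_dominated_convergence[where w="\<lambda>k. cmod (\<phi> k) * E"])
    show "integrable lborel (\<lambda>k. cmod (\<phi> k) * E)"
      using \<phi> by (intro integrable_mult_left integrable_norm)
    show "AE k in lborel. (\<lambda>m. \<phi> k * cis (k * \<sigma>) * picard w m t k n) \<longlonglongrightarrow> \<phi> k * cis (k * \<sigma>) * x t k n"
      using picard_tendsto[OF \<open>0 \<le> t\<close>] by (intro AE_I2 tendsto_mult tendsto_const)
    show "AE k in lborel. norm (\<phi> k * cis (k * \<sigma>) * picard w m t k n) \<le> cmod (\<phi> k) * E" for m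
    proof (rule AE_I2)
      fix k
      have "(2 * A * t) ^ m / fact m \<le> exp (2 * A * t)"
        using sum_le_suminf[OF summable_exp_generic[of "2 * A * t"], of "{m}"] A_nonneg \<open>0 \<le> t\<close>
        by (simp add: exp_def divide_inverse mult.commute)
      then have "cmod (picard w m t k n) \<le> E"
        unfolding E_def using picard_bound[of t t m k n] \<open>0 \<le> t\<close> by auto
      then show "norm (\<phi> k * cis (k * \<sigma>) * picard w m t k n) \<le> cmod (\<phi> k) * E"
        by (simp add: norm_mult mult_left_mono)
    qed
  qed measurable
  then show ?thesis
    using vanish_picard[OF assms(3,4)] by (simp add: LIMSEQ_const_iff)
qed

end

section \<open>From weak solutions to continuous ones\<close>

lemma exists_bounded_borel_version:
  fixes v :: "real \<Rightarrow> real"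
  assumes v: "v \<in> borel_measurable (lebesgue_on {0..})"
    and bound: "\<And>t. 0 \<le> t \<Longrightarrow> \<bar>v t\<bar> \<le> A"
  obtains w where "w \<in> borel_measurable borel" "\<And>t. \<bar>w t\<bar> \<le> A"
    "AE t in lebesgue. 0 \<le> t \<longrightarrow> v t = w t"
proof -
  have "(\<lambda>t. if t \<in> {0..} then v t else 0) \<in> borel_measurable lebesgue"
    using v by (rule borel_measurable_if_I) (simp only: atLeast_borel sets_completionI_sets sets_lborel)
  then obtain g where g: "g \<in> borel_measurable lborel" "AE t in lborel. (if t \<in> {0..} then v t else 0) = g t"
    using completion_ex_borel_measurable_real by blast
  have A: "0 \<le> A" using bound[of 0] by linarith
  show ?thesis
  proof (rule that[of "\<lambda>t. max (- A) (min A (g t))"])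
    show "(\<lambda>t. max (- A) (min A (g t))) \<in> borel_measurable borel" using g(1) by simp
    show "\<bar>max (- A) (min A (g t))\<bar> \<le> A" for t using A by linarith
    have "AE t in lebesgue. (if t \<in> {0..} then v t else 0) = g t"
      using g(2) by (rule AE_completion)
    then show "AE t in lebesgue. 0 \<le> t \<longrightarrow> v t = max (- A) (min A (g t))"
    proof eventually_elim
      case (elim t)
      then show ?case using bound[of t] by (auto simp: max_def min_def)
    qed
  qed
qed

lemma ell2_coordinate_le:
  assumes "z \<in> ell2"
  shows "cmod (z n) \<le> ell2_norm z"
proof -
  have "(\<Sum>i\<in>{n}. (cmod (z i))\<^sup>2) \<le> (\<Sum>i. (cmod (z i))\<^sup>2)"
    using assms by (intro sum_le_suminf) (auto simp: ell2_def)
  then show ?thesis unfolding ell2_norm_def by (intro real_le_rsqrt) simp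
qed

text \<open>
  Each coordinate, freed of its phase, is an indefinite integral, hence continuous. The local bound is uniform in the site
  because a coordinate of the integrand is at most its \<open>\<ell>\<^sup>2\<close> norm, whose integral is finite. A null set
  of times may be changed in the coefficient without affecting any integral.
\<close>

lemma duhamel_solution_imp_ladder_evolution:
  assumes sol: "duhamel_solution v k y"
    and w [measurable]: "w \<in> borel_measurable borel"
    and w_bound: "\<And>s. \<bar>w s\<bar> \<le> A"
    and vw: "AE s in lebesgue. 0 \<le> s \<longrightarrow> v s = w s"
  shows "ladder_evolution w A k (\<lambda>t. y (max 0 t))"
proof -
  define F where "F = (\<lambda>t s. free_evol (k * (t - s)) (Qop (v s) (y s)))"
  define G where "G = (\<lambda>s n. cis (- (k * s * (real n)\<^sup>2)) * Qop (v s) (y s) n)"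
  have y_ell2: "y t \<in> ell2" if "0 \<le> t" for t
    using sol that unfolding duhamel_solution_def by blast
  have F_int: "ell2_integrable {0..t} (F t)" if "0 \<le> t" for t
    using sol that unfolding duhamel_solution_def F_def by blast
  have y_eq: "y t n = free_evol (k * t) delta0 n + \<i> * (LINT s:{0..t}|lebesgue. F t s n)" if "0 \<le> t" for t n
    using sol that unfolding duhamel_solution_def F_def ell2_integral_def by blast
  have F_ell2: "cmod (F t s n) \<le> ell2_norm (F t s)" if "s \<in> {0..t}" for t s n
    using F_int[of t] that by (intro ell2_coordinate_le) (auto simp: ell2_integrable_def)
  have F_n: "set_integrable lebesgue {0..t} (\<lambda>s. F t s n)" if t: "0 \<le> t" for t n
  proof (rule set_integrable_bound)
    show "set_integrable lebesgue {0..t} (\<lambda>s. ell2_norm (F t s))"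
      "set_borel_measurable lebesgue {0..t} (\<lambda>s. F t s n)"
      using F_int[OF t] by (auto simp: ell2_integrable_def)
    show "AE s in lebesgue. s \<in> {0..t} \<longrightarrow> norm (F t s n) \<le> norm (ell2_norm (F t s))"
      unfolding real_norm_def by (intro AE_I2 impI order_trans[OF F_ell2 abs_ge_self])
  qed
  have FG: "F t s n = cis (k * t * (real n)\<^sup>2) * G s n" for t s n
    by (simp add: F_def G_def free_evol_def cis_mult mult.assoc[symmetric]) (simp add: algebra_simps)
  have GF: "G s n = cis (- (k * t * (real n)\<^sup>2)) * F t s n" for t s n
    by (simp add: FG cis_mult mult.assoc[symmetric])
  have G_int: "set_integrable lebesgue {0..t} (\<lambda>s. G s n)" if "0 \<le> t" for t n
    unfolding GF[of _ n t] by (intro set_integrable_mult_right F_n that)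
  have y_G: "y t n = cis (k * t * (real n)\<^sup>2) * (delta0 n + \<i> * (LINT s:{0..t}|lebesgue. G s n))"
    if "0 \<le> t" for t n
    unfolding y_eq[OF that] FG by (simp add: free_evol_def algebra_simps)
  have continuous_part: "continuous_on {0..T} (\<lambda>t. y t n)" for T n
  proof (cases "0 \<le> T")
    case True
    have "(\<lambda>s. G s n) integrable_on {0..T}"
      using G_int[OF True] by (rule set_lebesgue_integral_eq_integral)
    then have "continuous_on {0..T} (\<lambda>t. integral {0..t} (\<lambda>s. G s n))"
      by (rule indefinite_integral_continuous_1)
    then have "continuous_on {0..T} (\<lambda>t. cis (k * t * (real n)\<^sup>2) * (delta0 n + \<i> * integral {0..t} (\<lambda>s. G s n)))"
      unfolding cis_conv_exp by (intro continuous_intros)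
    then show ?thesis
      by (rule continuous_on_eq) (use set_lebesgue_integral_eq_integral(2)[OF G_int] y_G in auto)
  qed simp
  have continuous: "continuous_on UNIV (\<lambda>t. y (max 0 t) n)" for n
  proof (rule continuous_at_imp_continuous_on, rule ballI)
    fix t :: real
    define T where "T = max 0 t + 1"
    have "continuous_on {..<T} (\<lambda>t. y (max 0 t) n)"
      by (rule continuous_on_compose2[OF continuous_part[of T n]])
        (auto simp: T_def intro!: continuous_intros)
    then show "isCont (\<lambda>t. y (max 0 t) n) t"
      by (subst (asm) continuous_on_eq_continuous_at) (auto simp: T_def)
  qed
  then have [measurable]: "(\<lambda>t. y (max 0 t) n) \<in> borel_measurable borel" for n
    by (rule borel_measurable_continuous_onI)
  show ?thesis
  proof
    show "w \<in> borel_measurable borel" "\<And>s. \<bar>w s\<bar> \<le> A" by fact+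
    show "summable (\<lambda>n. (cmod (y (max 0 t) n))\<^sup>2)" for t
      using y_ell2[of "max 0 t"] by (simp add: ell2_def)
    show "continuous_on UNIV (\<lambda>t. y (max 0 t) n)" for n by fact
    show "\<exists>K. \<forall>t\<in>{0..T}. \<forall>n. cmod (y (max 0 t) n) \<le> K" for T
    proof (intro exI ballI allI)
      fix t n assume t: "t \<in> {0..T}"
      then have T: "0 \<le> T" and t0: "0 \<le> t" by auto
      have int_T: "set_integrable lebesgue {0..T} (\<lambda>s. ell2_norm (F T s))"
        using F_int[OF T] by (simp add: ell2_integrable_def)
      have "cmod (LINT s:{0..t}|lebesgue. G s n) \<le> (LINT s:{0..t}|lebesgue. cmod (G s n))"
        by (rule set_integral_norm_bound[OF G_int[OF t0]])
      also have "\<dots> \<le> (LINT s:{0..T}|lebesgue. ell2_norm (F T s))"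
        unfolding set_lebesgue_integral_def
      proof (rule integral_mono)
        show "integrable lebesgue (\<lambda>s. indicator {0..t} s *\<^sub>R cmod (G s n))"
          using set_integrable_norm[OF G_int[OF t0]] by (simp add: set_integrable_def)
        show "integrable lebesgue (\<lambda>s. indicator {0..T} s *\<^sub>R ell2_norm (F T s))"
          using int_T by (simp add: set_integrable_def)
        fix s
        have "cmod (G s n) \<le> ell2_norm (F T s)" if "s \<in> {0..T}"
          using F_ell2[OF that, of n] by (simp add: FG norm_mult)
        moreover have "0 \<le> ell2_norm (F T s)" if "s \<in> {0..T}"
          using F_ell2[OF that, of n] by (rule order_trans[OF norm_ge_zero])
        ultimately show "indicator {0..t} s *\<^sub>R cmod (G s n) \<le> indicator {0..T} s *\<^sub>R ell2_norm (F T s)"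
          using t by (auto simp: indicator_def)
      qed
      finally have "cmod (\<i> * (LINT s:{0..t}|lebesgue. G s n)) \<le> (LINT s:{0..T}|lebesgue. ell2_norm (F T s))"
        by (simp add: norm_mult)
      moreover have "cmod (delta0 n) \<le> 1" by (simp add: delta0_def)
      ultimately have "cmod (delta0 n + \<i> * (LINT s:{0..t}|lebesgue. G s n)) \<le> 1 + (LINT s:{0..T}|lebesgue. ell2_norm (F T s))"
        by (intro order_trans[OF norm_triangle_ineq] add_mono)
      then show "cmod (y (max 0 t) n) \<le> 1 + (LINT s:{0..T}|lebesgue. ell2_norm (F T s))"
        using t0 by (simp add: y_G norm_mult)
    qed
    show "y (max 0 t) n = free_evol (k * t) delta0 n
      + \<i> * (LINT s:{0..t}|lborel. free_evol (k * (t - s)) (Qop (w s) (y (max 0 s))) n)" if t: "0 \<le> t" for t n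
    proof -
      have [measurable]: "(\<lambda>s. indicator {0..t} s *\<^sub>R free_evol (k * (t - s)) (Qop (w s) (y (max 0 s))) n) \<in> borel_measurable borel"
        unfolding free_evol_def Qop_def by (cases n) simp_all
      have "(LINT s:{0..t}|lebesgue. F t s n)
        = (LINT s:{0..t}|lebesgue. free_evol (k * (t - s)) (Qop (w s) (y (max 0 s))) n)"
        unfolding set_lebesgue_integral_def
      proof (rule integral_cong_AE)
        show "(\<lambda>s. indicator {0..t} s *\<^sub>R F t s n) \<in> borel_measurable lebesgue"
          using F_n[OF t, of n] by (auto simp: set_integrable_def)
        show "AE s in lebesgue. indicator {0..t} s *\<^sub>R F t s n
          = indicator {0..t} s *\<^sub>R free_evol (k * (t - s)) (Qop (w s) (y (max 0 s))) n"
          using vw by eventually_elim (auto simp: F_def indicator_def)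
      qed (rule measurable_completion, measurable)
      also have "\<dots> = (LINT s:{0..t}|lborel. free_evol (k * (t - s)) (Qop (w s) (y (max 0 s))) n)"
        unfolding set_lebesgue_integral_def by (rule integral_completion) measurable
      finally show ?thesis using t by (simp add: y_eq)
    qed
  qed
qed

section \<open>The Fejer kernel\<close>

definition fejer :: "real \<Rightarrow> real" where
  "fejer k = (1 - cos k) / k\<^sup>2"

lemma fejer_measurable [measurable]: "fejer \<in> borel_measurable borel"
  unfolding fejer_def by measurable

lemma fejer_nonneg: "0 \<le> fejer k"
  by (simp add: fejer_def)

lemma fejer_minus: "fejer (- k) = fejer k"
  by (simp add: fejer_def)

lemma one_minus_cos_le: "1 - cos k \<le> k\<^sup>2 / 2" for k :: real
proof -
  have "cos k = 1 - 2 * (sin (k / 2))\<^sup>2" using cos_double_sin[of "k / 2"] by simp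
  moreover have "(sin (k / 2))\<^sup>2 \<le> (k / 2)\<^sup>2"
    using abs_sin_x_le_abs_x[of "k / 2"] by (simp only: abs_le_square_iff)
  ultimately show ?thesis by (simp add: power_divide)
qed

lemma fejer_le: "fejer k \<le> 4 * inverse (1 + k\<^sup>2)"
proof (cases "k\<^sup>2 \<le> 1")
  case True
  have "fejer k \<le> 1 / 2"
    using one_minus_cos_le[of k] by (cases "k = 0") (auto simp: fejer_def field_simps)
  also have "1 / 2 \<le> 4 * inverse (1 + k\<^sup>2)"
    using True by (simp add: field_simps add_pos_nonneg)
  finally show ?thesis .
next
  case False
  then have "fejer k \<le> 2 / k\<^sup>2"
    unfolding fejer_def using cos_ge_minus_one[of k] by (intro divide_right_mono) auto
  also have "\<dots> \<le> 4 * inverse (1 + k\<^sup>2)"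
  proof -
    have "0 < k\<^sup>2" "2 * (1 + k\<^sup>2) \<le> 4 * k\<^sup>2" using False by auto
    then have "2 / k\<^sup>2 \<le> 4 / (1 + k\<^sup>2)"
      by (subst frac_le_eq) (auto simp: divide_le_0_iff algebra_simps add_nonneg_eq_0_iff)
    then show ?thesis by (simp add: divide_inverse)
  qed
  finally show ?thesis .
qed

lemma fejer_integrable: "integrable lborel fejer"
proof (rule Bochner_Integration.integrable_bound)
  show "integrable lborel (\<lambda>k::real. 4 * inverse (1 + k\<^sup>2))"
    using integrable_inverse_1_plus_square by (simp add: set_integrable_def)
  show "AE k in lborel. norm (fejer k) \<le> norm (4 * inverse (1 + k\<^sup>2))"
    using fejer_le fejer_nonneg by (intro AE_I2) (simp add: add_nonneg_nonneg abs_of_nonneg)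
qed measurable

lemma fejer_scaled_integrable: "c \<noteq> 0 \<Longrightarrow> integrable lborel (\<lambda>k. fejer (c * k))"
  using lborel_integrable_real_affine[OF fejer_integrable, of c 0] by simp

definition fejer_mass :: real where
  "fejer_mass = (LINT k|lborel. fejer k)"

lemma fejer_mass_nonneg: "0 \<le> fejer_mass"
  unfolding fejer_mass_def by (simp add: fejer_nonneg)

lemma integral_fejer_scaled:
  assumes "c \<noteq> 0"
  shows "(LINT k|lborel. fejer (c * k)) = fejer_mass / \<bar>c\<bar>"
  using lborel_integral_real_affine[OF assms, of fejer 0] assms by (simp add: fejer_mass_def)

text \<open>
  The substitution \<open>k \<mapsto> ck\<close> in the integral of the Fejer kernel.
\<close>

lemma has_integral_one_minus_cos:
  "has_bochner_integral lborel (\<lambda>k. (1 - cos (c * k)) / k\<^sup>2) (\<bar>c\<bar> * fejer_mass)"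
proof (cases "c = 0")
  case False
  have "has_bochner_integral lborel (\<lambda>k. c\<^sup>2 * fejer (c * k)) (c\<^sup>2 * (fejer_mass / \<bar>c\<bar>))"
    using fejer_scaled_integrable[OF False] integral_fejer_scaled[OF False]
    by (intro has_bochner_integral_mult_right) (simp add: has_bochner_integral_iff)
  moreover have "(\<lambda>k. c\<^sup>2 * fejer (c * k)) = (\<lambda>k. (1 - cos (c * k)) / k\<^sup>2)"
    using False by (simp add: fejer_def power_mult_distrib fun_eq_iff)
  moreover have "c\<^sup>2 * (fejer_mass / \<bar>c\<bar>) = \<bar>c\<bar> * fejer_mass"
    using False by (simp add: field_simps power2_eq_square abs_if)
  ultimately show ?thesis by simp
qed (simp add: has_bochner_integral_zero)

text \<open>
  The Fourier transform of the Fejer kernel is the second difference of \<open>|\<sigma>|\<close>, a triangle function: the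
  product \<open>(1 - cos (\<epsilon>k)) cos (\<sigma>k)\<close> is a combination of \<open>1 - cos (ck)\<close> with \<open>c = \<sigma>, \<sigma> + \<epsilon>, \<sigma> - \<epsilon>\<close>, and \<open>|c|\<close>
  is linear as long as \<open>\<sigma> \<ge> \<epsilon>\<close>. The imaginary part vanishes by parity.
\<close>

lemma fejer_fourier_vanishes:
  assumes \<epsilon>: "0 < \<epsilon>" and \<sigma>: "\<epsilon> \<le> \<sigma>"
  shows "(LINT k|lborel. complex_of_real (fejer (\<epsilon> * k)) * cis (k * \<sigma>)) = 0"
proof -
  have int: "integrable lborel (\<lambda>k. complex_of_real (fejer (\<epsilon> * k)) * cis (k * \<sigma>))"
    by (rule Bochner_Integration.integrable_bound[OF fejer_scaled_integrable[of \<epsilon>]])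
      (use \<epsilon> in \<open>auto simp: norm_mult cis_conv_exp\<close>)
  have "(LINT k|lborel. fejer (\<epsilon> * k) * cos (k * \<sigma>)) = 0"
  proof -
    have "has_bochner_integral lborel
      (\<lambda>k. (- ((1 - cos (\<sigma> * k)) / k\<^sup>2) + ((1 - cos ((\<sigma> + \<epsilon>) * k)) / k\<^sup>2) / 2
            + ((1 - cos ((\<sigma> - \<epsilon>) * k)) / k\<^sup>2) / 2) / \<epsilon>\<^sup>2)
      ((- (\<bar>\<sigma>\<bar> * fejer_mass) + (\<bar>\<sigma> + \<epsilon>\<bar> * fejer_mass) / 2 + (\<bar>\<sigma> - \<epsilon>\<bar> * fejer_mass) / 2) / \<epsilon>\<^sup>2)"
      by (intro has_bochner_integral_divide_zero has_bochner_integral_add has_bochner_integral_minus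
          has_integral_one_minus_cos)
    also have "(\<lambda>k. (- ((1 - cos (\<sigma> * k)) / k\<^sup>2) + ((1 - cos ((\<sigma> + \<epsilon>) * k)) / k\<^sup>2) / 2
            + ((1 - cos ((\<sigma> - \<epsilon>) * k)) / k\<^sup>2) / 2) / \<epsilon>\<^sup>2) = (\<lambda>k. fejer (\<epsilon> * k) * cos (k * \<sigma>))"
    proof
      fix k
      have e1: "- (1 - cos (\<sigma> * k)) + (1 - cos ((\<sigma> + \<epsilon>) * k)) / 2 + (1 - cos ((\<sigma> - \<epsilon>) * k)) / 2
        = (1 - cos (\<epsilon> * k)) * cos (k * \<sigma>)"
        by (simp add: distrib_right left_diff_distrib cos_add cos_diff field_simps)
      have e2: "(- (a / q) + (b / q) / 2 + (c / q) / 2) / e = (- a + b / 2 + c / 2) / (e * q)"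
        for a b c q e :: real
        by (cases "e = 0"; cases "q = 0") (simp_all add: field_simps)
      show "(- ((1 - cos (\<sigma> * k)) / k\<^sup>2) + ((1 - cos ((\<sigma> + \<epsilon>) * k)) / k\<^sup>2) / 2
            + ((1 - cos ((\<sigma> - \<epsilon>) * k)) / k\<^sup>2) / 2) / \<epsilon>\<^sup>2 = fejer (\<epsilon> * k) * cos (k * \<sigma>)"
        unfolding e2 e1 by (simp add: fejer_def power_mult_distrib)
    qed
    finally show ?thesis
      using assms by (simp add: has_bochner_integral_iff field_simps)
  qed
  moreover have "(LINT k|lborel. fejer (\<epsilon> * k) * sin (k * \<sigma>)) = 0"
    using lborel_integral_real_affine[of "-1" "\<lambda>k. fejer (\<epsilon> * k) * sin (k * \<sigma>)" 0]
    by (simp add: fejer_minus)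
  moreover have "Re (LINT k|lborel. complex_of_real (fejer (\<epsilon> * k)) * cis (k * \<sigma>)) = (LINT k|lborel. fejer (\<epsilon> * k) * cos (k * \<sigma>))"
    by (subst integral_Re[OF int, symmetric]) simp
  moreover have "Im (LINT k|lborel. complex_of_real (fejer (\<epsilon> * k)) * cis (k * \<sigma>)) = (LINT k|lborel. fejer (\<epsilon> * k) * sin (k * \<sigma>))"
    by (subst integral_Im[OF int, symmetric]) simp
  ultimately show ?thesis
    by (simp only: complex_eq_iff zero_complex.sel)
qed

lemma fejer_tendsto_half: "(fejer \<longlongrightarrow> 1 / 2) (at 0)"
proof -
  have "filterlim (\<lambda>k::real. k / 2) (at 0) (at 0)"
    by (auto simp: filterlim_at eventually_at_filter intro!: tendsto_eq_intros)
  then have "((\<lambda>k::real. sin (k / 2) / (k / 2)) \<longlongrightarrow> 1) (at 0)"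
    by (rule filterlim_compose[OF sinc_at_0])
  then have "((\<lambda>k::real. (sin (k / 2) / (k / 2))\<^sup>2 / 2) \<longlongrightarrow> 1\<^sup>2 / 2) (at 0)"
    by (intro tendsto_intros) auto
  moreover have "(sin (k / 2) / (k / 2))\<^sup>2 / 2 = fejer k" for k :: real
    using cos_double_sin[of "k / 2"] by (simp add: fejer_def power_divide)
  ultimately show ?thesis by simp
qed

section \<open>The loss of ground state mass, integrated over the frequency\<close>

lemma norm_integral_le_nn_integral:
  fixes f :: "'a \<Rightarrow> 'b::{banach, second_countable_topology}"
  shows "ennreal (norm (LINT x|M. f x)) \<le> (\<integral>\<^sup>+ x. ennreal (norm (f x)) \<partial>M)"
proof (cases "integrable M f")
  case True
  then show ?thesis by (rule integral_norm_bound_ennreal)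
qed (simp add: not_integrable_integral_eq)

lemma band_measurable:
  "{(s, r). s - \<epsilon> \<le> r \<and> r \<le> s} \<in> sets (borel \<Otimes>\<^sub>M borel)" for \<epsilon> :: real
proof -
  have "{p \<in> space (borel \<Otimes>\<^sub>M borel). fst p - \<epsilon> \<le> snd p \<and> snd p \<le> fst p} \<in> sets (borel \<Otimes>\<^sub>M borel)"
    by measurable
  then show ?thesis by (simp add: space_pair_measure case_prod_unfold)
qed

text \<open>
  Schur's test for the indicator of the band \<open>s - \<epsilon> \<le> r \<le> s\<close>: rows and columns both have mass \<open>\<epsilon>\<close>, and
  \<open>f s f r \<le> (f s\<^sup>2 + f r\<^sup>2) / 2\<close>.
\<close>

lemma nn_integral_band_product_le:
  fixes f :: "real \<Rightarrow> real"
  assumes [measurable]: "f \<in> borel_measurable borel" and \<epsilon>: "0 \<le> \<epsilon>"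
  shows "(\<integral>\<^sup>+ s. \<integral>\<^sup>+ r. ennreal (f s * f r) * indicator {s - \<epsilon>..s} r \<partial>lborel \<partial>lborel)
    \<le> ennreal \<epsilon> * (\<integral>\<^sup>+ s. ennreal ((f s)\<^sup>2) \<partial>lborel)"
proof -
  define g where "g = (\<lambda>s. ennreal ((f s)\<^sup>2 / 2))"
  have [measurable]: "g \<in> borel_measurable borel" unfolding g_def by measurable
  have ind: "(indicator {s - \<epsilon>..s} r :: ennreal) = indicator {(s, r). s - \<epsilon> \<le> r \<and> r \<le> s} (s, r)" for s r
    by (simp add: indicator_def)
  note band_measurable [measurable]
  have row: "(\<integral>\<^sup>+ r. g s * indicator {s - \<epsilon>..s} r \<partial>lborel) = ennreal \<epsilon> * g s" for s
    using \<epsilon> by (simp add: nn_integral_cmult emeasure_lborel_Icc_eq mult.commute)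
  have column: "(\<integral>\<^sup>+ s. g r * indicator {s - \<epsilon>..s} r \<partial>lborel) = ennreal \<epsilon> * g r" for r
  proof -
    have column_ind: "(indicator {s - \<epsilon>..s} r :: ennreal) = indicator {r..r + \<epsilon>} s" for s
      by (auto simp: indicator_def)
    show ?thesis
      unfolding column_ind using \<epsilon> by (simp add: nn_integral_cmult emeasure_lborel_Icc_eq mult.commute)
  qed
  have "(\<integral>\<^sup>+ s. \<integral>\<^sup>+ r. ennreal (f s * f r) * indicator {s - \<epsilon>..s} r \<partial>lborel \<partial>lborel)
     \<le> (\<integral>\<^sup>+ s. \<integral>\<^sup>+ r. g s * indicator {s - \<epsilon>..s} r + g r * indicator {s - \<epsilon>..s} r \<partial>lborel \<partial>lborel)"
  proof (intro nn_integral_mono)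
    fix s r :: real
    have "0 \<le> (f s - f r)\<^sup>2" by simp
    then have "f s * f r \<le> (f s)\<^sup>2 / 2 + (f r)\<^sup>2 / 2" by (simp add: power2_diff)
    then have "ennreal (f s * f r) \<le> ennreal ((f s)\<^sup>2 / 2 + (f r)\<^sup>2 / 2)" by (rule ennreal_leI)
    also have "\<dots> = g s + g r" unfolding g_def by (rule ennreal_plus) auto
    finally have "ennreal (f s * f r) \<le> g s + g r" .
    then show "ennreal (f s * f r) * indicator {s - \<epsilon>..s} r \<le> g s * indicator {s - \<epsilon>..s} r + g r * indicator {s - \<epsilon>..s} r"
      by (simp add: indicator_def)
  qed
  also have "\<dots> = (\<integral>\<^sup>+ s. \<integral>\<^sup>+ r. g s * indicator {s - \<epsilon>..s} r \<partial>lborel \<partial>lborel)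
      + (\<integral>\<^sup>+ s. \<integral>\<^sup>+ r. g r * indicator {s - \<epsilon>..s} r \<partial>lborel \<partial>lborel)"
    unfolding ind by (subst nn_integral_add[symmetric]) (simp_all add: nn_integral_add)
  also have "(\<integral>\<^sup>+ s. \<integral>\<^sup>+ r. g r * indicator {s - \<epsilon>..s} r \<partial>lborel \<partial>lborel)
     = (\<integral>\<^sup>+ r. \<integral>\<^sup>+ s. g r * indicator {s - \<epsilon>..s} r \<partial>lborel \<partial>lborel)"
    unfolding ind by (rule lborel_pair.Fubini') measurable
  finally have "(\<integral>\<^sup>+ s. \<integral>\<^sup>+ r. ennreal (f s * f r) * indicator {s - \<epsilon>..s} r \<partial>lborel \<partial>lborel)
    \<le> ennreal \<epsilon> * (2 * (\<integral>\<^sup>+ s. g s \<partial>lborel))"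
    unfolding row column by (simp add: nn_integral_cmult mult_2 distrib_left)
  also have "2 * (\<integral>\<^sup>+ s. g s \<partial>lborel) = (\<integral>\<^sup>+ s. 2 * g s \<partial>lborel)"
    by (simp add: nn_integral_cmult)
  also have "(\<lambda>s. 2 * g s) = (\<lambda>s. ennreal ((f s)\<^sup>2))"
  proof
    fix s
    have "2 * g s = ennreal 2 * ennreal ((f s)\<^sup>2 / 2)" by (simp add: g_def)
    also have "\<dots> = ennreal ((f s)\<^sup>2)" by (subst ennreal_mult[symmetric]) auto
    finally show "2 * g s = ennreal ((f s)\<^sup>2)" .
  qed
  finally show ?thesis .
qed

context ladder_family begin

lemma w_square_integrable: "set_integrable lborel {0..T} (\<lambda>s. (w s)\<^sup>2)"
  using w_bound A_nonneg by (intro set_integrable_bounded_Icc[where B="A\<^sup>2"]) (auto simp: abs_le_square_iff[symmetric])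

text \<open>
  In Duhamel's formula for site 1 the source at time \<open>r\<close> carries the delay \<open>s - r\<close>. If the delay exceeds \<open>\<epsilon>\<close>, the
  average of the source is zero; otherwise it is at most the mass of the kernel times \<open>2|w r|\<close>.
\<close>

lemma first_site_fejer_average:
  assumes \<epsilon>: "0 < \<epsilon>" and s: "0 \<le> s"
  shows "ennreal (cmod (LINT k|lborel. complex_of_real (fejer (\<epsilon> * k)) * x s k 1))
    \<le> (\<integral>\<^sup>+ r. ennreal (2 * (fejer_mass / \<epsilon>)) * (ennreal \<bar>w r\<bar> * (indicator {0..s} r * indicator {s - \<epsilon>..s} r)) \<partial>lborel)"
proof -
  define \<phi> where "\<phi> = (\<lambda>k. complex_of_real (fejer (\<epsilon> * k)))"
  have \<phi>: "integrable lborel \<phi>"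
    unfolding \<phi>_def using fejer_scaled_integrable[of \<epsilon>] \<epsilon> by simp
  have \<phi>_norm: "(LINT k|lborel. cmod (\<phi> k)) = fejer_mass / \<epsilon>"
    using integral_fejer_scaled[of \<epsilon>] \<epsilon> by (simp add: \<phi>_def abs_of_nonneg[OF fejer_nonneg])
  have vanish: "(LINT k|lborel. \<phi> k * cis (k * \<sigma>)) = 0" if "\<epsilon> \<le> \<sigma>" for \<sigma>
    unfolding \<phi>_def using \<epsilon> that by (rule fejer_fourier_vanishes)
  have [measurable]: "\<phi> \<in> borel_measurable borel"
    using borel_measurable_integrable[OF \<phi>] by simp
  define g where "g = (\<lambda>r k. free_evol (k * (s - r)) (Qop (w r) (x r k)) 1)"
  have [measurable]: "(\<lambda>(r, k). g r k) \<in> borel_measurable (borel \<Otimes>\<^sub>M borel)"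
    unfolding g_def free_evol_def Qop_def by simp
  have g_le: "cmod (g r k) \<le> 2 * A * 1" for r k
    unfolding g_def by (intro cmod_free_evol_Qop_le cmod_x_le_1)
  have g_le': "cmod (g r k) \<le> 2 * \<bar>w r\<bar>" for r k
  proof -
    have "cmod (x r k 0 + x r k 2) \<le> 1 + 1"
      by (intro order_trans[OF norm_triangle_ineq] add_mono cmod_x_le_1)
    then show ?thesis
      using mult_left_mono[of "cmod (x r k 0 + x r k 2)" 2 "\<bar>w r\<bar>"]
      by (simp add: g_def free_evol_def Qop_def norm_mult numeral_2_eq_2 mult.commute)
  qed
  have phase: "integrable lborel (\<lambda>k. \<phi> k * cis (k * \<sigma>) * x r k n)" for \<sigma> r n
    by (rule Bochner_Integration.integrable_bound[OF \<phi>])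
      (auto simp: norm_mult intro!: mult_left_le cmod_x_le_1)
  have far: "(LINT k|lborel. \<phi> k * g r k) = 0" if "0 \<le> r" "r < s - \<epsilon>" for r
  proof -
    have "\<phi> k * g r k = complex_of_real (w r) * (\<phi> k * cis (k * (s - r)) * x r k 0 + \<phi> k * cis (k * (s - r)) * x r k 2)" for k
      by (simp add: g_def free_evol_def Qop_def numeral_2_eq_2 algebra_simps)
    moreover have "(LINT k|lborel. \<phi> k * cis (k * (s - r)) * x r k n) = 0" for n
      using that by (intro fourier_vanishes[OF \<phi> vanish]) auto
    ultimately show ?thesis using phase by simp
  qed
  have near: "cmod (LINT k|lborel. \<phi> k * g r k) \<le> 2 * (fejer_mass / \<epsilon>) * \<bar>w r\<bar>" for r
  proof -
    have "cmod (LINT k|lborel. \<phi> k * g r k) \<le> (LINT k|lborel. cmod (\<phi> k) * (2 * \<bar>w r\<bar>))"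
    proof (rule Bochner_Integration.integral_norm_bound_integral)
      show dom: "integrable lborel (\<lambda>k. cmod (\<phi> k) * (2 * \<bar>w r\<bar>))"
        using \<phi> by (intro integrable_mult_left integrable_norm)
      show pt: "norm (\<phi> k * g r k) \<le> cmod (\<phi> k) * (2 * \<bar>w r\<bar>)" for k
        using g_le'[of r k] by (simp add: norm_mult mult_left_mono)
      show "integrable lborel (\<lambda>k. \<phi> k * g r k)"
        by (rule Bochner_Integration.integrable_bound[OF dom]) (measurable, use pt in auto)
    qed
    then show ?thesis by (simp add: \<phi>_norm mult_ac)
  qed
  have "x s k 1 = \<i> * (LINT r:{0..s}|lborel. g r k)" for k
    using ladder_evolution.duhamel[OF evolution s, of k 1] by (simp add: g_def free_evol_def delta0_def)
  then have "(LINT k|lborel. \<phi> k * x s k 1) = \<i> * (LINT k|lborel. \<phi> k * (LINT r:{0..s}|lborel. g r k))"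
    by (simp add: mult.left_commute[of _ \<i>])
  also have "(LINT k|lborel. \<phi> k * (LINT r:{0..s}|lborel. g r k)) = (LINT r:{0..s}|lborel. (LINT k|lborel. \<phi> k * g r k))"
    by (rule weighted_integral_Icc_swap(2)[OF \<phi> _ g_le s]) measurable
  finally have "ennreal (cmod (LINT k|lborel. \<phi> k * x s k 1))
     \<le> (\<integral>\<^sup>+ r. ennreal (norm (indicator {0..s} r *\<^sub>R (LINT k|lborel. \<phi> k * g r k))) \<partial>lborel)"
    unfolding set_lebesgue_integral_def
    using norm_integral_le_nn_integral[of lborel "\<lambda>r. indicator {0..s} r *\<^sub>R (LINT k|lborel. \<phi> k * g r k)"]
    by (simp add: norm_mult)
  also have "\<dots> \<le> (\<integral>\<^sup>+ r. ennreal (2 * (fejer_mass / \<epsilon>)) * (ennreal \<bar>w r\<bar> * (indicator {0..s} r * indicator {s - \<epsilon>..s} r)) \<partial>lborel)"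
  proof (rule nn_integral_mono)
    fix r
    have nn: "0 \<le> 2 * (fejer_mass / \<epsilon>)" using fejer_mass_nonneg \<epsilon> by simp
    consider "r \<notin> {0..s}" | "r \<in> {0..s}" "r < s - \<epsilon>" | "r \<in> {0..s}" "s - \<epsilon> \<le> r" by linarith
    then show "ennreal (norm (indicator {0..s} r *\<^sub>R (LINT k|lborel. \<phi> k * g r k)))
      \<le> ennreal (2 * (fejer_mass / \<epsilon>)) * (ennreal \<bar>w r\<bar> * (indicator {0..s} r * indicator {s - \<epsilon>..s} r))"
    proof cases
      case 3
      then show ?thesis
        using ennreal_leI[OF near[of r]] ennreal_mult[OF nn abs_ge_zero[of "w r"]] by simp
    qed (simp_all add: far)
  qed
  finally show ?thesis by (simp add: \<phi>_def)
qed

text \<open>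
  The mass of the kernel is \<open>fejer_mass / \<epsilon>\<close> and the band of admissible delays has width \<open>\<epsilon>\<close>, so \<open>\<epsilon>\<close> cancels.
\<close>

lemma fejer_average_le:
  assumes \<epsilon>: "0 < \<epsilon>" and T: "0 \<le> T"
  shows "cmod (LINT k|lborel. complex_of_real (fejer (\<epsilon> * k)) * (1 - x T k 0))
    \<le> 2 * fejer_mass * (LINT s:{0..T}|lborel. (w s)\<^sup>2)"
proof -
  define \<phi> where "\<phi> = (\<lambda>k. complex_of_real (fejer (\<epsilon> * k)))"
  have \<phi>: "integrable lborel \<phi>"
    unfolding \<phi>_def using fejer_scaled_integrable[of \<epsilon>] \<epsilon> by simp
  define f where "f = (\<lambda>s. indicator {0..T} s * \<bar>w s\<bar>)"
  have [measurable]: "f \<in> borel_measurable borel" unfolding f_def by measurable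
  have f0: "0 \<le> f s" for s by (simp add: f_def)
  have nn: "0 \<le> 2 * (fejer_mass / \<epsilon>)" using fejer_mass_nonneg \<epsilon> by simp
  define g where "g = (\<lambda>s k. complex_of_real (w s) * x s k 1)"
  have [measurable]: "(\<lambda>(s, k). g s k) \<in> borel_measurable (borel \<Otimes>\<^sub>M borel)"
    unfolding g_def by measurable
  have g_le: "cmod (g s k) \<le> A" for s k
    unfolding g_def norm_mult using mult_mono[OF w_bound[of s] cmod_x_le_1[of s k 1]] A_nonneg by simp
  have "1 - x T k 0 = - (\<i> * (LINT s:{0..T}|lborel. g s k))" for k
    using ladder_evolution.duhamel[OF evolution T, of k 0]
    by (simp add: g_def free_evol_def Qop_def delta0_def)
  then have "(LINT k|lborel. \<phi> k * (1 - x T k 0)) = - (\<i> * (LINT k|lborel. \<phi> k * (LINT s:{0..T}|lborel. g s k)))"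
    by (simp add: mult.left_commute[of _ \<i>])
  also have "(LINT k|lborel. \<phi> k * (LINT s:{0..T}|lborel. g s k)) = (LINT s:{0..T}|lborel. (LINT k|lborel. \<phi> k * g s k))"
    by (rule weighted_integral_Icc_swap(2)[OF \<phi> _ g_le T]) measurable
  also have "(\<lambda>s. (LINT k|lborel. \<phi> k * g s k)) = (\<lambda>s. complex_of_real (w s) * (LINT k|lborel. \<phi> k * x s k 1))"
    by (simp add: g_def mult.left_commute[of "\<phi> _"])
  finally have "ennreal (cmod (LINT k|lborel. \<phi> k * (1 - x T k 0)))
     \<le> (\<integral>\<^sup>+ s. ennreal (norm (indicator {0..T} s *\<^sub>R (complex_of_real (w s) * (LINT k|lborel. \<phi> k * x s k 1)))) \<partial>lborel)"
    unfolding set_lebesgue_integral_def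
    using norm_integral_le_nn_integral[of lborel "\<lambda>s. indicator {0..T} s *\<^sub>R (complex_of_real (w s) * (LINT k|lborel. \<phi> k * x s k 1))"]
    by (simp add: norm_mult)
  also have "\<dots> \<le> (\<integral>\<^sup>+ s. \<integral>\<^sup>+ r. ennreal (2 * (fejer_mass / \<epsilon>)) * (ennreal (f s * f r) * indicator {s - \<epsilon>..s} r) \<partial>lborel \<partial>lborel)"
  proof (rule nn_integral_mono)
    fix s
    show "ennreal (norm (indicator {0..T} s *\<^sub>R (complex_of_real (w s) * (LINT k|lborel. \<phi> k * x s k 1))))
      \<le> (\<integral>\<^sup>+ r. ennreal (2 * (fejer_mass / \<epsilon>)) * (ennreal (f s * f r) * indicator {s - \<epsilon>..s} r) \<partial>lborel)"
    proof (cases "s \<in> {0..T}")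
      case True
      have "ennreal (norm (indicator {0..T} s *\<^sub>R (complex_of_real (w s) * (LINT k|lborel. \<phi> k * x s k 1))))
        = ennreal (f s) * ennreal (cmod (LINT k|lborel. \<phi> k * x s k 1))"
        using True by (simp add: f_def norm_mult ennreal_mult)
      also have "\<dots> \<le> ennreal (f s) * (\<integral>\<^sup>+ r. ennreal (2 * (fejer_mass / \<epsilon>)) * (ennreal \<bar>w r\<bar> * (indicator {0..s} r * indicator {s - \<epsilon>..s} r)) \<partial>lborel)"
        unfolding \<phi>_def using True by (intro mult_left_mono first_site_fejer_average \<epsilon>) auto
      also have "\<dots> = (\<integral>\<^sup>+ r. ennreal (f s) * (ennreal (2 * (fejer_mass / \<epsilon>)) * (ennreal \<bar>w r\<bar> * (indicator {0..s} r * indicator {s - \<epsilon>..s} r))) \<partial>lborel)"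
        by (rule nn_integral_cmult[symmetric]) measurable
      also have "\<dots> \<le> (\<integral>\<^sup>+ r. ennreal (2 * (fejer_mass / \<epsilon>)) * (ennreal (f s * f r) * indicator {s - \<epsilon>..s} r) \<partial>lborel)"
      proof (rule nn_integral_mono)
        fix r
        have "ennreal \<bar>w r\<bar> * indicator {0..s} r \<le> ennreal (f r)"
          using True by (auto simp: f_def indicator_def)
        then have "ennreal (2 * (fejer_mass / \<epsilon>)) * (ennreal (f s) * (ennreal \<bar>w r\<bar> * indicator {0..s} r) * indicator {s - \<epsilon>..s} r)
          \<le> ennreal (2 * (fejer_mass / \<epsilon>)) * (ennreal (f s) * ennreal (f r) * indicator {s - \<epsilon>..s} r)"
          by (intro mult_left_mono mult_right_mono) auto
        then show "ennreal (f s) * (ennreal (2 * (fejer_mass / \<epsilon>)) * (ennreal \<bar>w r\<bar> * (indicator {0..s} r * indicator {s - \<epsilon>..s} r)))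
          \<le> ennreal (2 * (fejer_mass / \<epsilon>)) * (ennreal (f s * f r) * indicator {s - \<epsilon>..s} r)"
          using f0 by (simp add: ennreal_mult mult_ac)
      qed
      finally show ?thesis .
    qed simp
  qed
  also have "\<dots> = ennreal (2 * (fejer_mass / \<epsilon>)) * (\<integral>\<^sup>+ s. \<integral>\<^sup>+ r. ennreal (f s * f r) * indicator {s - \<epsilon>..s} r \<partial>lborel \<partial>lborel)"
  proof -
    have ind: "(indicator {s - \<epsilon>..s} r :: ennreal) = indicator {(s, r). s - \<epsilon> \<le> r \<and> r \<le> s} (s, r)" for s r
      by (simp add: indicator_def)
    note band_measurable [measurable]
    show ?thesis unfolding ind by (simp add: nn_integral_cmult)
  qed
  also have "\<dots> \<le> ennreal (2 * (fejer_mass / \<epsilon>)) * (ennreal \<epsilon> * (\<integral>\<^sup>+ s. ennreal ((f s)\<^sup>2) \<partial>lborel))"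
    using \<epsilon> by (intro mult_left_mono nn_integral_band_product_le) auto
  also have "(\<integral>\<^sup>+ s. ennreal ((f s)\<^sup>2) \<partial>lborel) = ennreal (LINT s:{0..T}|lborel. (w s)\<^sup>2)"
  proof -
    have "(\<lambda>s. ennreal ((f s)\<^sup>2)) = (\<lambda>s. ennreal (indicator {0..T} s *\<^sub>R (w s)\<^sup>2))"
      by (auto simp: f_def indicator_def fun_eq_iff)
    then show ?thesis
      using w_square_integrable[of T] unfolding set_lebesgue_integral_def set_integrable_def
      by (simp add: nn_integral_eq_integral)
  qed
  also have "ennreal (2 * (fejer_mass / \<epsilon>)) * (ennreal \<epsilon> * ennreal (LINT s:{0..T}|lborel. (w s)\<^sup>2))
     = ennreal (2 * fejer_mass * (LINT s:{0..T}|lborel. (w s)\<^sup>2))"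
  proof -
    have "0 \<le> (LINT s:{0..T}|lborel. (w s)\<^sup>2)" unfolding set_lebesgue_integral_def by simp
    then show ?thesis using nn \<epsilon> by (simp add: ennreal_mult[symmetric] mult.assoc)
  qed
  finally show ?thesis
    unfolding \<phi>_def set_lebesgue_integral_def
    by (subst (asm) ennreal_le_iff) (simp_all add: fejer_mass_nonneg)
qed

text \<open>
  The elementary inequality \<open>1 - |z|\<^sup>2 \<le> 2 (1 - |z|) \<le> 2 Re (1 - z)\<close> replaces the quadratic quantity by a linear one, to
  which Fejer averages apply. As \<open>Re (1 - z) \<ge> 0\<close>, Fatou's lemma removes the kernel, which tends to \<open>1/2\<close>.
\<close>

lemma ground_state_loss_integral_le:
  assumes T: "0 \<le> T"
  shows "(\<integral>\<^sup>+ k. ennreal (1 - (cmod (x T k 0))\<^sup>2) \<partial>lborel)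
    \<le> ennreal (8 * fejer_mass * (LINT s:{0..T}|lborel. (w s)\<^sup>2))"
proof -
  define I where "I = (LINT s:{0..T}|lborel. (w s)\<^sup>2)"
  have I: "0 \<le> I" unfolding I_def set_lebesgue_integral_def by simp
  define d where "d = (\<lambda>k. 1 - Re (x T k 0))"
  have d0: "0 \<le> d k" for k
    unfolding d_def using complex_Re_le_cmod[of "x T k 0"] cmod_x_le_1[of T k 0] by linarith
  have [measurable]: "d \<in> borel_measurable borel" unfolding d_def by measurable
  define F where "F = (\<lambda>j k. ennreal (fejer (inverse (real (Suc j)) * k) * d k))"
  have F_le: "(\<integral>\<^sup>+ k. F j k \<partial>lborel) \<le> ennreal (2 * fejer_mass * I)" for j
  proof -
    define \<epsilon> where "\<epsilon> = inverse (real (Suc j))"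
    have \<epsilon>: "0 < \<epsilon>" by (simp add: \<epsilon>_def)
    have int: "integrable lborel (\<lambda>k. complex_of_real (fejer (\<epsilon> * k)) * (1 - x T k 0))"
    proof (rule Bochner_Integration.integrable_bound)
      show "integrable lborel (\<lambda>k. fejer (\<epsilon> * k) * 2)"
        using fejer_scaled_integrable[of \<epsilon>] \<epsilon> by simp
      show "AE k in lborel. norm (complex_of_real (fejer (\<epsilon> * k)) * (1 - x T k 0)) \<le> norm (fejer (\<epsilon> * k) * 2)"
      proof (rule AE_I2)
        fix k
        have "cmod (1 - x T k 0) \<le> 2"
          using norm_triangle_ineq4[of 1 "x T k 0"] cmod_x_le_1[of T k 0] by simp
        then show "norm (complex_of_real (fejer (\<epsilon> * k)) * (1 - x T k 0)) \<le> norm (fejer (\<epsilon> * k) * 2)"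
          unfolding norm_mult norm_of_real real_norm_def abs_mult by (intro mult_left_mono) auto
      qed
    qed measurable
    have Re_eq: "Re (complex_of_real (fejer (\<epsilon> * k)) * (1 - x T k 0)) = fejer (\<epsilon> * k) * d k" for k
      by (simp add: d_def)
    have int_Re: "integrable lborel (\<lambda>k. fejer (\<epsilon> * k) * d k)"
      using integrable_Re[OF int] unfolding Re_eq .
    have "(\<integral>\<^sup>+ k. F j k \<partial>lborel) = ennreal (LINT k|lborel. fejer (\<epsilon> * k) * d k)"
      unfolding F_def \<epsilon>_def[symmetric]
      by (intro nn_integral_eq_integral int_Re AE_I2 mult_nonneg_nonneg fejer_nonneg d0)
    also have "(LINT k|lborel. fejer (\<epsilon> * k) * d k) = Re (LINT k|lborel. complex_of_real (fejer (\<epsilon> * k)) * (1 - x T k 0))"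
      using integral_Re[OF int] unfolding Re_eq .
    also have "\<dots> \<le> 2 * fejer_mass * I"
      using order_trans[OF complex_Re_le_cmod fejer_average_le[OF \<epsilon> T]] by (simp add: I_def)
    finally show ?thesis by (simp add: ennreal_leI)
  qed
  have lim: "(\<lambda>j. F j k) \<longlonglongrightarrow> ennreal (1 / 2 * d k)" if "k \<noteq> 0" for k
  proof -
    have "filterlim (\<lambda>j. inverse (real (Suc j)) * k) (at 0) sequentially"
      using that LIMSEQ_inverse_real_of_nat
      by (auto simp: filterlim_at intro!: tendsto_mult_left_zero)
    then have "(\<lambda>j. fejer (inverse (real (Suc j)) * k)) \<longlonglongrightarrow> 1 / 2"
      by (rule filterlim_compose[OF fejer_tendsto_half])
    then show ?thesis
      unfolding F_def by (intro tendsto_ennrealI tendsto_mult tendsto_const)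
  qed
  have "(\<integral>\<^sup>+ k. ennreal (1 - (cmod (x T k 0))\<^sup>2) \<partial>lborel) \<le> (\<integral>\<^sup>+ k. 4 * liminf (\<lambda>j. F j k) \<partial>lborel)"
  proof (rule nn_integral_mono_AE)
    show "AE k in lborel. ennreal (1 - (cmod (x T k 0))\<^sup>2) \<le> 4 * liminf (\<lambda>j. F j k)"
      using AE_lborel_singleton[of 0]
    proof eventually_elim
      case (elim k)
      define c where "c = cmod (x T k 0)"
      have "0 \<le> (1 - c)\<^sup>2" by simp
      then have "1 - c\<^sup>2 \<le> 2 * (1 - c)" by (simp add: power2_diff)
      also have "\<dots> \<le> 4 * (1 / 2 * d k)"
        unfolding d_def c_def using complex_Re_le_cmod[of "x T k 0"] by simp
      finally have "ennreal (1 - c\<^sup>2) \<le> ennreal (4 * (1 / 2 * d k))" by (rule ennreal_leI)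
      also have "\<dots> = ennreal 4 * ennreal (1 / 2 * d k)" using d0[of k] by (intro ennreal_mult) auto
      also have "ennreal (1 / 2 * d k) = liminf (\<lambda>j. F j k)"
        using lim_imp_Liminf[OF _ lim[OF elim]] by simp
      finally show ?case by (simp add: c_def)
    qed
  qed
  also have "\<dots> = 4 * (\<integral>\<^sup>+ k. liminf (\<lambda>j. F j k) \<partial>lborel)"
    unfolding F_def by (rule nn_integral_cmult) measurable
  also have "\<dots> \<le> 4 * liminf (\<lambda>j. \<integral>\<^sup>+ k. F j k \<partial>lborel)"
    unfolding F_def by (intro mult_left_mono nn_integral_liminf) auto
  also have "\<dots> \<le> 4 * ennreal (2 * fejer_mass * I)"
    using F_le by (intro mult_left_mono) (auto intro!: Liminf_le always_eventually)
  also have "\<dots> = ennreal 4 * ennreal (2 * fejer_mass * I)" by simp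
  also have "\<dots> = ennreal (8 * fejer_mass * I)"
    using I fejer_mass_nonneg by (subst ennreal_mult[symmetric]) (auto simp: mult_ac)
  finally show ?thesis by (simp add: I_def)
qed

end

section \<open>Interpolation\<close>

text \<open>
  The exponent \<open>p = \<infinity>\<close> is included with \<open>1/p = 0\<close>. Since \<open>0 powr 0 = 0\<close>, the bound then reads \<open>0\<close> when \<open>D = 0\<close>, which is
  correct because \<open>f\<close> vanishes almost everywhere in that case.
\<close>

lemma Lp_norm_interpolation:
  fixes f :: "'a \<Rightarrow> real"
  assumes [measurable]: "f \<in> borel_measurable M"
    and f: "\<And>x. 0 \<le> f x" "\<And>x. f x \<le> B"
    and D: "(\<integral>\<^sup>+ x. ennreal (f x) \<partial>M) \<le> ennreal D" "0 \<le> D"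
    and B: "0 \<le> B" and p: "1 \<le> p"
  shows "Lp_norm M p f \<le> ennreal (B powr (1 - enn2real (inverse p)) * D powr enn2real (inverse p))"
proof (cases "p = \<infinity>")
  case True
  have "AE x in M. ennreal \<bar>f x\<bar> \<le> ennreal (B * D powr 0)"
  proof (cases "D = 0")
    case True
    then have "(\<integral>\<^sup>+ x. ennreal (f x) \<partial>M) = 0" using D by simp
    then have "AE x in M. ennreal (f x) = 0" by (subst (asm) nn_integral_0_iff_AE) auto
    then show ?thesis by eventually_elim (use f(1) True in \<open>simp add: order_antisym\<close>)
  next
    case False
    then show ?thesis using f by (auto intro!: AE_I2 ennreal_leI)
  qed
  then have "esssup M (\<lambda>x. ennreal \<bar>f x\<bar>) \<le> ennreal (B * D powr 0)"
    by (intro esssup_I) auto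
  then show ?thesis using True B by (simp add: Lp_norm_def)
next
  case False
  define q where "q = enn2real p"
  have p_eq: "p = ennreal q" using False by (simp add: q_def less_top)
  have "0 \<le> q" by (simp add: q_def)
  then have q: "1 \<le> q" using p by (simp add: p_eq ennreal_le_iff flip: ennreal_1)
  have inv: "enn2real (inverse p) = 1 / q"
    using q by (simp add: p_eq inverse_ennreal divide_inverse)
  define I where "I = (\<integral>\<^sup>+ x. ennreal (\<bar>f x\<bar> powr q) \<partial>M)"
  have "I \<le> (\<integral>\<^sup>+ x. ennreal (B powr (q - 1)) * ennreal (f x) \<partial>M)"
    unfolding I_def
  proof (rule nn_integral_mono)
    fix x
    have "f x powr q \<le> B powr (q - 1) * f x"
    proof (cases "f x = 0")
      case False
      then have "f x powr q = f x powr (q - 1) * f x"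
        using f(1)[of x] by (simp add: powr_diff)
      also have "\<dots> \<le> B powr (q - 1) * f x"
        using f[of x] q by (intro mult_mono powr_mono2) auto
      finally show ?thesis .
    qed simp
    then show "ennreal (\<bar>f x\<bar> powr q) \<le> ennreal (B powr (q - 1)) * ennreal (f x)"
      using f(1)[of x] by (simp add: ennreal_leI flip: ennreal_mult)
  qed
  also have "\<dots> = ennreal (B powr (q - 1)) * (\<integral>\<^sup>+ x. ennreal (f x) \<partial>M)"
    by (rule nn_integral_cmult) measurable
  also have "\<dots> \<le> ennreal (B powr (q - 1)) * ennreal D"
    by (intro mult_left_mono D) auto
  finally have I: "I \<le> ennreal (B powr (q - 1) * D)" using D(2) by (simp add: ennreal_mult)
  then have "I \<noteq> top" by (auto simp: top_unique)
  moreover have "enn2real I powr (1 / q) \<le> (B powr (q - 1) * D) powr (1 / q)"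
    using enn2real_mono[OF I] q D(2) by (intro powr_mono2) auto
  moreover have "(B powr (q - 1) * D) powr (1 / q) = B powr (1 - 1 / q) * D powr (1 / q)"
    using q D(2) by (simp add: powr_mult powr_powr diff_divide_distrib right_diff_distrib)
  ultimately show ?thesis
    using False by (simp add: Lp_norm_def I_def inv q_def[symmetric] Let_def ennreal_leI)
qed

lemma japanese_bracket_powr_le_1:
  assumes "0 \<le> \<gamma>"
  shows "japanese_bracket t powr (- \<gamma>) \<le> 1"
proof -
  have "1 \<le> japanese_bracket t" by (simp add: japanese_bracket_def)
  then have "japanese_bracket t powr (- \<gamma>) \<le> japanese_bracket t powr 0"
    using assms by (intro powr_mono) auto
  also have "\<dots> = 1" using \<open>1 \<le> japanese_bracket t\<close> by simp
  finally show ?thesis .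
qed

text \<open>
  The decay of \<open>v\<close> makes it bounded. The constants \<open>16\<close> and \<open>8 * fejer_mass\<close> of the two
  estimates are merged into their sum, which dominates every geometric mean of them.
\<close>

theorem theorem5p3:
  shows "\<exists>C::real. C > 0 \<and>
    (\<forall>(\<gamma>::real) (v :: real \<Rightarrow> real) (x :: real \<Rightarrow> real \<Rightarrow> nat \<Rightarrow> complex).
      \<gamma> > 3 / 4 \<longrightarrow>
      v \<in> borel_measurable (lebesgue_on {0..}) \<longrightarrow>
      (\<exists>A::real. \<forall>t\<ge>0. \<bar>v t\<bar> \<le> A * japanese_bracket t powr (- \<gamma>)) \<longrightarrow>
      (\<forall>k. duhamel_solution v k (\<lambda>t. x t k)) \<longrightarrow>
      (\<forall>(p::ennreal) (N::nat) (T::real). 2 \<le> p \<longrightarrow> N > 1 \<longrightarrow> T > 0 \<longrightarrow>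
        Lp_norm lebesgue p (\<lambda>k. tail_mass N (x T k))
        \<le> ennreal (C * real N powr (- 2 + 2 * enn2real (inverse p))
            * (LINT t:{0..T}|lebesgue. \<bar>v t\<bar>) powr (2 - 2 * enn2real (inverse p))
            * (LINT t:{0..T}|lebesgue. (v t)\<^sup>2) powr enn2real (inverse p))))"
proof (intro exI[of _ "16 + 8 * fejer_mass"] conjI allI impI)
  show "0 < 16 + 8 * fejer_mass" using fejer_mass_nonneg by linarith
  fix \<gamma> T :: real and v :: "real \<Rightarrow> real" and x :: "real \<Rightarrow> real \<Rightarrow> nat \<Rightarrow> complex" and p :: ennreal and N :: nat
  assume \<gamma>: "\<gamma> > 3 / 4" and v: "v \<in> borel_measurable (lebesgue_on {0..})"
    and "\<exists>A::real. \<forall>t\<ge>0. \<bar>v t\<bar> \<le> A * japanese_bracket t powr (- \<gamma>)"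
    and sol: "\<forall>k. duhamel_solution v k (\<lambda>t. x t k)"
    and p: "2 \<le> p" and N: "N > 1" and T: "T > 0"
  then obtain A' where A': "\<And>t. 0 \<le> t \<Longrightarrow> \<bar>v t\<bar> \<le> A' * japanese_bracket t powr (- \<gamma>)" by blast
  define A where "A = \<bar>A'\<bar>"
  have "\<bar>v t\<bar> \<le> A" if "0 \<le> t" for t
  proof -
    have "A' * japanese_bracket t powr (- \<gamma>) \<le> A * 1"
      using japanese_bracket_powr_le_1[of \<gamma> t] \<gamma> unfolding A_def by (intro mult_mono) auto
    then show ?thesis using A'[OF that] by simp
  qed
  then obtain w where w [measurable]: "w \<in> borel_measurable borel" and w_bound: "\<And>t. \<bar>w t\<bar> \<le> A"
    and vw: "AE t in lebesgue. 0 \<le> t \<longrightarrow> v t = w t"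
    using exists_bounded_borel_version[OF v] by blast
  define X where "X = (\<lambda>t. x (max 0 t))"
  interpret ladder_family w A X
  proof (rule ladder_family.intro)
    show "ladder_evolution w A k (\<lambda>t. X t k)" for k
      unfolding X_def using sol by (intro duhamel_solution_imp_ladder_evolution[OF _ w w_bound vw]) auto
    show "X t k = X 0 k" if "t \<le> 0" for t k
      using that by (simp add: X_def max_def)
  qed
  define I1 where "I1 = (LINT t:{0..T}|lborel. \<bar>w t\<bar>)"
  define I2 where "I2 = (LINT t:{0..T}|lborel. (w t)\<^sup>2)"
  have to_lborel: "(LINT t:{0..T}|lebesgue. h (v t)) = (LINT t:{0..T}|lborel. h (w t))"
    if [measurable]: "h \<in> borel_measurable borel" for h :: "real \<Rightarrow> real"
  proof -
    have "(\<lambda>t. if t \<in> {0..} then v t else 0) \<in> borel_measurable lebesgue"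
      using v by (rule borel_measurable_if_I) (simp only: atLeast_borel sets_completionI_sets sets_lborel)
    then have "(\<lambda>t. h (if t \<in> {0..} then v t else 0)) \<in> borel_measurable lebesgue"
      using that by (rule measurable_compose)
    then have "(\<lambda>t. indicator {0..T} t *\<^sub>R h (if t \<in> {0..} then v t else 0)) \<in> borel_measurable lebesgue"
      by (intro borel_measurable_scaleR borel_measurable_indicator sets_completionI_sets) simp_all
    moreover have "(\<lambda>t. indicator {0..T} t *\<^sub>R h (if t \<in> {0..} then v t else 0)) = (\<lambda>t. indicator {0..T} t *\<^sub>R h (v t))"
      by (auto simp: indicator_def)
    ultimately have "(LINT t:{0..T}|lebesgue. h (v t)) = (LINT t:{0..T}|lebesgue. h (w t))"
      unfolding set_lebesgue_integral_def
    proof (intro integral_cong_AE)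
      show "(\<lambda>t. indicator {0..T} t *\<^sub>R h (w t)) \<in> borel_measurable lebesgue"
        by (rule measurable_completion) measurable
      show "AE t in lebesgue. indicator {0..T} t *\<^sub>R h (v t) = indicator {0..T} t *\<^sub>R h (w t)"
        using vw by eventually_elim (auto simp: indicator_def)
    qed simp
    also have "\<dots> = (LINT t:{0..T}|lborel. h (w t))"
      unfolding set_lebesgue_integral_def by (rule integral_completion) measurable
    finally show ?thesis .
  qed
  have I: "0 \<le> I1" "0 \<le> I2"
    unfolding I1_def I2_def set_lebesgue_integral_def by simp_all
  define \<theta> where "\<theta> = enn2real (inverse p)"
  have \<theta>: "0 \<le> \<theta>" "\<theta> \<le> 1"
  proof -
    show "\<theta> \<le> 1"
    proof (cases p)
      case (real r)
      then have "2 \<le> r" using p ennreal_le_iff[of r 2] by simp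
      then show ?thesis using real by (simp add: \<theta>_def inverse_ennreal divide_simps)
    qed (simp add: \<theta>_def)
  qed (simp add: \<theta>_def)
  define S where "S = (\<lambda>k. tail_mass N (X T k))"
  have S_eq: "S k = 1 - (\<Sum>n<N. (cmod (X T k n))\<^sup>2)" for k
    unfolding S_def using T by (intro ladder_evolution.tail_mass_eq[OF evolution]) auto
  have S_measurable: "S \<in> borel_measurable borel" unfolding S_eq[abs_def] by measurable
  define B where "B = 16 * I1\<^sup>2 / (real N)\<^sup>2"
  define D where "D = 8 * fejer_mass * I2"
  have S_le: "S k \<le> B" for k
    unfolding S_def B_def I1_def using T N by (intro ladder_evolution.tail_mass_le[OF evolution]) auto
  have S_int: "(\<integral>\<^sup>+ k. ennreal (S k) \<partial>lebesgue) \<le> ennreal D"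
  proof -
    have "S k \<le> 1 - (cmod (X T k 0))\<^sup>2" for k
    proof -
      have "(\<Sum>n\<in>{0}. (cmod (X T k n))\<^sup>2) \<le> (\<Sum>n<N. (cmod (X T k n))\<^sup>2)"
        using N by (intro sum_mono2) auto
      then show ?thesis by (simp add: S_eq)
    qed
    then have "(\<integral>\<^sup>+ k. ennreal (S k) \<partial>lborel) \<le> (\<integral>\<^sup>+ k. ennreal (1 - (cmod (X T k 0))\<^sup>2) \<partial>lborel)"
      by (intro nn_integral_mono ennreal_leI)
    also have "\<dots> \<le> ennreal D"
      unfolding D_def I2_def using T by (intro ground_state_loss_integral_le) auto
    finally show ?thesis
      using S_measurable by (simp add: nn_integral_completion)
  qed
  have B0: "0 \<le> B" "0 \<le> D" using I fejer_mass_nonneg by (auto simp: B_def D_def)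
  have "Lp_norm lebesgue p S \<le> ennreal (B powr (1 - \<theta>) * D powr \<theta>)"
    unfolding \<theta>_def
  proof (rule Lp_norm_interpolation[OF _ _ S_le S_int])
    show "S \<in> borel_measurable lebesgue"
      using S_measurable by (intro measurable_completion) simp
    show "0 \<le> S k" for k
      unfolding S_def using T by (intro ladder_evolution.tail_mass_nonneg[OF evolution]) auto
    show "1 \<le> p" using p by (rule order_trans[rotated]) simp
  qed (use B0 in auto)
  also have "B powr (1 - \<theta>) * D powr \<theta>
    = (16 powr (1 - \<theta>) * (8 * fejer_mass) powr \<theta>) * (real N powr (- 2 + 2 * \<theta>) * I1 powr (2 - 2 * \<theta>) * I2 powr \<theta>)"
  proof -
    have sq: "a\<^sup>2 powr (1 - \<theta>) = a powr (2 - 2 * \<theta>)" if "0 \<le> a" for a :: real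
      using that by (cases "a = 0") (simp_all add: powr_powr algebra_simps flip: powr_numeral)
    have "B powr (1 - \<theta>) = 16 powr (1 - \<theta>) * I1 powr (2 - 2 * \<theta>) / real N powr (2 - 2 * \<theta>)"
      unfolding B_def using I N by (simp add: powr_mult powr_divide sq)
    also have "\<dots> = 16 powr (1 - \<theta>) * I1 powr (2 - 2 * \<theta>) * real N powr (- 2 + 2 * \<theta>)"
      using powr_minus_divide[of "real N" "2 - 2 * \<theta>"] by simp
    finally show ?thesis
      unfolding D_def using I fejer_mass_nonneg by (simp add: powr_mult)
  qed
  also have "ennreal \<dots> \<le> ennreal ((16 + 8 * fejer_mass) * (real N powr (- 2 + 2 * \<theta>) * I1 powr (2 - 2 * \<theta>) * I2 powr \<theta>))"
  proof (intro ennreal_leI mult_right_mono)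
    have "16 powr (1 - \<theta>) * (8 * fejer_mass) powr \<theta>
      \<le> (16 + 8 * fejer_mass) powr (1 - \<theta>) * (16 + 8 * fejer_mass) powr \<theta>"
      using \<theta> fejer_mass_nonneg by (intro mult_mono powr_mono2) auto
    also have "\<dots> = 16 + 8 * fejer_mass"
      using fejer_mass_nonneg by (simp flip: powr_add)
    finally show "16 powr (1 - \<theta>) * (8 * fejer_mass) powr \<theta> \<le> 16 + 8 * fejer_mass" .
  qed simp
  finally show "Lp_norm lebesgue p (\<lambda>k. tail_mass N (x T k))
        \<le> ennreal ((16 + 8 * fejer_mass) * real N powr (- 2 + 2 * enn2real (inverse p))
            * (LINT t:{0..T}|lebesgue. \<bar>v t\<bar>) powr (2 - 2 * enn2real (inverse p))
            * (LINT t:{0..T}|lebesgue. (v t)\<^sup>2) powr enn2real (inverse p))"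
    using to_lborel[of abs] to_lborel[of "\<lambda>a. a\<^sup>2"] T
    by (simp add: S_def X_def I1_def I2_def \<theta>_def mult.assoc)
qed

end
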